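(* Let $\phi$ be a continuous adapted cocycle on a Hilbert space $X$ satisfying Assumption A below, let $\pi$ be a continuous linear projection of $X$ onto a finite-dimensional subspace $\pi(X)\cong\mathbb R^m$, and suppose that for some fixed $u\in X$ and $t>0$ the Malliavin covariance matrix $M_t(u,W)$ is non-degenerate, i.e. $\mathbb P\big(\langle M_t(u,W)\xi,\xi\rangle_X>0\text{ for all }\xi\in X\setminus\{0\}\big)=1$. Then the law of the random variable $\pi(\phi_t(u,W))$ is absolutely continuous with respect to Lebesgue measure on $\pi(X)\cong\mathbb R^m$.
   Context: $\mathcal Z$ finite; $\Omega=\{V:\mathbb R\to\mathbb R^{|\mathcal Z|}$ continuous, $V(0)=0\}$ with two-sided Wiener measure $\mathbb P$, canonical process $W$, shift $\theta_s V(t)=V(t+s)-V(s)$; $\Omega_t$ the paths on $[0,t]$ with sup norm; Cameron–Martin space $\mathcal H_t=\{H\in H^1([0,t];\mathbb R^{|\mathcal Z|}):H(0)=0\}$ with $\langle H,G\rangle=\int_0^t\dot H\cdot\dot G\,ds$. A continuous adapted cocycle is a continuous $\phi:[0,\infty)\times X\times\Omega\to X$ with $\phi_0(u,V)=u$, $\phi_{t+s}(u,V)=\phi_t(\phi_s(u,V),\theta_sV)$, and $\phi_t(u,V)$ depending only on $V|_{[0,t]}$. Fixed elements $\sigma_k\in X$, $k\in\mathcal Z$. Assumption A: (i) for every $u,t$, $\phi_t(u,\cdot)$ is Fr\'echet differentiable in the directions of $\mathcal H_t$, with derivative $D_w\phi_t(u,V)H$; (ii) for fixed $V$, $\phi_t(\cdot,V)$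 is Fr\'echet differentiable on $X$ with derivative $D_u\phi$, and $(t,u,V,\xi)\mapsto D_u\phi_t(u,V)\xi$ is continuous; (iii) $D_u\phi_t(v,V)\xi\neq0$ for $\xi\ne0$; (iv) $D_w\phi_t(u,V)H=\sum_{k\in\mathcal Z}\int_0^tJ_{s,t}(u,V)\sigma_k\dot H_k(s)\,ds$ for $H\in\mathcal H_t$, where $J_{s,t}(u,V)\xi=(D_u\phi_{t-s})(\phi_s(u,V),\theta_sV)\xi$; (v) the adjoint $J^*_{s,t}(u,V)$ is injective for all $s\le t$. The Malliavin matrix is $\langle M_t(u,V)\xi,\rho\rangle_X=\sum_{k\in\mathcal Z}\int_0^t\langle J_{s,t}(u,V)\sigma_k,\xi\rangle_X\langle J_{s,t}(u,V)\sigma_k,\rho\rangle_Xds$, i.e. $M_t=D_w\phi_t(D_w\phi_t)^*$. *)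

theory Defs
  imports "HOL-Probability.Probability"
begin

definition wiener_paths :: "(real \<Rightarrow> real^'z) set" where
  "wiener_paths = {V. continuous_on UNIV V \<and> V 0 = 0}"

definition shift :: "real \<Rightarrow> (real \<Rightarrow> real^'z) \<Rightarrow> real \<Rightarrow> real^'z" where
  "shift s V = (\<lambda>r. V (r + s) - V s)"

definition bm_cov :: "real \<Rightarrow> real \<Rightarrow> real" where
  "bm_cov s t = (if 0 \<le> s \<and> 0 \<le> t then min s t
                 else if s \<le> 0 \<and> t \<le> 0 then min (- s) (- t) else 0)"

text \<open>P is two-sided Wiener measure on the canonical space: a probability measure on the
  continuous paths vanishing at 0, with the sigma-algebra generated by the evaluations,
  under which the canonical process is a centred Gaussian process whose coordinates are
  independent two-sided standard Brownian motions (characterised by the characteristic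
  functions of its finite-dimensional marginals).\<close>
definition two_sided_wiener :: "(real \<Rightarrow> real^'z) measure \<Rightarrow> bool" where
  "two_sided_wiener P \<longleftrightarrow>
     prob_space P \<and> space P = wiener_paths \<and>
     sets P = sigma_sets wiener_paths
                {{V \<in> wiener_paths. V t \<in> A} | t A. A \<in> sets (borel :: (real^'z) measure)} \<and>
     (\<forall>(ts :: real list) (as :: (real^'z) list). length as = length ts \<longrightarrow>
        integral\<^sup>L P (\<lambda>V. cis (\<Sum>k<length ts. as ! k \<bullet> V (ts ! k)))
        = complex_of_real (exp (- (\<Sum>k<length ts. \<Sum>l<length ts.
                (as ! k \<bullet> as ! l) * bm_cov (ts ! k) (ts ! l)) / 2)))"

definition loc_unif_conv :: "(nat \<Rightarrow> real \<Rightarrow> real^'z) \<Rightarrow> (real \<Rightarrow> real^'z) \<Rightarrow> bool" where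
  "loc_unif_conv Vs V \<longleftrightarrow>
     (\<forall>T \<epsilon>. \<epsilon> > 0 \<longrightarrow> eventually (\<lambda>n. \<forall>s \<in> {-T..T}. norm (Vs n s - V s) < \<epsilon>) sequentially)"

definition adapted_cocycle ::
  "(real \<Rightarrow> 'x::real_normed_vector \<Rightarrow> (real \<Rightarrow> real^'z) \<Rightarrow> 'x) \<Rightarrow> bool" where
  "adapted_cocycle \<phi> \<longleftrightarrow>
     (\<forall>u V. V \<in> wiener_paths \<longrightarrow> \<phi> 0 u V = u) \<and>
     (\<forall>t s u V. 0 \<le> t \<longrightarrow> 0 \<le> s \<longrightarrow> V \<in> wiener_paths \<longrightarrow>
        \<phi> (t + s) u V = \<phi> t (\<phi> s u V) (shift s V)) \<and>
     (\<forall>t u V V'. 0 \<le> t \<longrightarrow> V \<in> wiener_paths \<longrightarrow> V' \<in> wiener_paths \<longrightarrow>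
        (\<forall>r \<in> {0..t}. V r = V' r) \<longrightarrow> \<phi> t u V = \<phi> t u V') \<and>
     (\<forall>ts t us u Vs V. (\<forall>n. 0 \<le> ts n \<and> Vs n \<in> wiener_paths) \<longrightarrow> 0 \<le> t \<longrightarrow>
        V \<in> wiener_paths \<longrightarrow> ts \<longlonglongrightarrow> t \<longrightarrow> us \<longlonglongrightarrow> u \<longrightarrow> loc_unif_conv Vs V \<longrightarrow>
        (\<lambda>n. \<phi> (ts n) (us n) (Vs n)) \<longlonglongrightarrow> \<phi> t u V)"

text \<open>An element H of the Cameron--Martin space H_t is represented by its derivative h,
  a square-integrable function on [0,t]; H(s) = integral of h over [0,s].
  The path H is extended by 0 for s <= 0 and by H(t) for s >= t.\<close>
definition cm_space :: "real \<Rightarrow> (real \<Rightarrow> real^'z) set" where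
  "cm_space t = {h. h \<in> borel_measurable lebesgue \<and>
                     integrable (lebesgue_on {0..t}) (\<lambda>s. (norm (h s))\<^sup>2)}"

definition cm_norm :: "real \<Rightarrow> (real \<Rightarrow> real^'z) \<Rightarrow> real" where
  "cm_norm t h = sqrt (integral\<^sup>L (lebesgue_on {0..t}) (\<lambda>s. (norm (h s))\<^sup>2))"

definition cm_path :: "real \<Rightarrow> (real \<Rightarrow> real^'z) \<Rightarrow> real \<Rightarrow> real^'z" where
  "cm_path t h = (\<lambda>s. if s \<le> 0 then 0 else integral\<^sup>L (lebesgue_on {0..min s t}) h)"

definition jac ::
  "(real \<Rightarrow> 'x \<Rightarrow> (real \<Rightarrow> real^'z) \<Rightarrow> 'x) \<Rightarrow>
   (real \<Rightarrow> 'x \<Rightarrow> (real \<Rightarrow> real^'z) \<Rightarrow> 'x \<Rightarrow> 'x) \<Rightarrow>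
   real \<Rightarrow> real \<Rightarrow> 'x \<Rightarrow> (real \<Rightarrow> real^'z) \<Rightarrow> 'x \<Rightarrow> 'x" where
  "jac \<phi> Du s t u V = Du (t - s) (\<phi> s u V) (shift s V)"

definition malliavin_deriv ::
  "(real \<Rightarrow> 'x::real_normed_vector \<Rightarrow> (real \<Rightarrow> real^'z::finite) \<Rightarrow> 'x) \<Rightarrow>
   (real \<Rightarrow> 'x \<Rightarrow> (real \<Rightarrow> real^'z) \<Rightarrow> 'x \<Rightarrow> 'x) \<Rightarrow> ('z \<Rightarrow> 'x) \<Rightarrow>
   real \<Rightarrow> 'x \<Rightarrow> (real \<Rightarrow> real^'z) \<Rightarrow> (real \<Rightarrow> real^'z) \<Rightarrow> 'x" where
  "malliavin_deriv \<phi> Du \<sigma> t u V h =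
     (\<Sum>k\<in>UNIV. integral {0..t} (\<lambda>s. (h s $ k) *\<^sub>R jac \<phi> Du s t u V (\<sigma> k)))"

definition malliavin_form ::
  "(real \<Rightarrow> 'x::real_inner \<Rightarrow> (real \<Rightarrow> real^'z::finite) \<Rightarrow> 'x) \<Rightarrow>
   (real \<Rightarrow> 'x \<Rightarrow> (real \<Rightarrow> real^'z) \<Rightarrow> 'x \<Rightarrow> 'x) \<Rightarrow> ('z \<Rightarrow> 'x) \<Rightarrow>
   real \<Rightarrow> 'x \<Rightarrow> (real \<Rightarrow> real^'z) \<Rightarrow> 'x \<Rightarrow> 'x \<Rightarrow> real" where
  "malliavin_form \<phi> Du \<sigma> t u V \<xi> \<rho> =
     (\<Sum>k\<in>UNIV. integral {0..t}
        (\<lambda>s. (jac \<phi> Du s t u V (\<sigma> k) \<bullet> \<xi>) * (jac \<phi> Du s t u V (\<sigma> k) \<bullet> \<rho>)))"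

text \<open>Du t u V is the Frechet derivative of phi_t(.,V) at u.  Items (i) and (iv) are
  combined: phi_t(u,.) is Frechet differentiable along H_t with derivative given by (iv).
  Item (v): the adjoint of J_{s,t} is injective, i.e. <J xi, eta> = 0 for all xi forces eta = 0.\<close>
definition assumption_A ::
  "(real \<Rightarrow> 'x::real_inner \<Rightarrow> (real \<Rightarrow> real^'z::finite) \<Rightarrow> 'x) \<Rightarrow>
   (real \<Rightarrow> 'x \<Rightarrow> (real \<Rightarrow> real^'z) \<Rightarrow> 'x \<Rightarrow> 'x) \<Rightarrow> ('z \<Rightarrow> 'x) \<Rightarrow> bool" where
  "assumption_A \<phi> Du \<sigma> \<longleftrightarrow>
     \<comment> \<open>(i) + (iv)\<close>
     (\<forall>t u V. 0 \<le> t \<longrightarrow> V \<in> wiener_paths \<longrightarrow>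
        (\<forall>\<epsilon>>0. \<exists>\<delta>>0. \<forall>h \<in> cm_space t. cm_norm t h < \<delta> \<longrightarrow>
           norm (\<phi> t u (\<lambda>s. V s + cm_path t h s) - \<phi> t u V - malliavin_deriv \<phi> Du \<sigma> t u V h)
             \<le> \<epsilon> * cm_norm t h)) \<and>
     \<comment> \<open>(ii)\<close>
     (\<forall>t u V. 0 \<le> t \<longrightarrow> V \<in> wiener_paths \<longrightarrow>
        ((\<lambda>v. \<phi> t v V) has_derivative Du t u V) (at u)) \<and>
     (\<forall>ts t us u Vs V xs x. (\<forall>n. 0 \<le> ts n \<and> Vs n \<in> wiener_paths) \<longrightarrow> 0 \<le> t \<longrightarrow>
        V \<in> wiener_paths \<longrightarrow> ts \<longlonglongrightarrow> t \<longrightarrow> us \<longlonglongrightarrow> u \<longrightarrow> loc_unif_conv Vs V \<longrightarrow>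
        xs \<longlonglongrightarrow> x \<longrightarrow> (\<lambda>n. Du (ts n) (us n) (Vs n) (xs n)) \<longlonglongrightarrow> Du t u V x) \<and>
     \<comment> \<open>(iii)\<close>
     (\<forall>t v V \<xi>. 0 \<le> t \<longrightarrow> V \<in> wiener_paths \<longrightarrow> \<xi> \<noteq> 0 \<longrightarrow> Du t v V \<xi> \<noteq> 0) \<and>
     \<comment> \<open>(v)\<close>
     (\<forall>s t u V \<eta>. 0 \<le> s \<longrightarrow> s \<le> t \<longrightarrow> V \<in> wiener_paths \<longrightarrow>
        (\<forall>\<xi>. jac \<phi> Du s t u V \<xi> \<bullet> \<eta> = 0) \<longrightarrow> \<eta> = 0)"

end

theory Submission
  imports Defs
begin

text \<open>
  Write \<open>F V = \<iota> (\<pi> (\<phi> t u V))\<close> and let \<open>N\<close> be a Lebesgue null set. Cut \<open>[0, t]\<close> into \<open>n\<close> equal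
  cells and pick as many distinct pairs (cell, noise coordinate) as the target has dimensions. The
  normalised increments of the canonical process over these cells are independent standard Gaussians,
  dual to the Cameron--Martin paths \<open>H b\<close> whose derivatives are the normalised cell indicators, so
  replacing them by an independent Gaussian vector \<open>a\<close> preserves Wiener measure. By Fubini it
  suffices that for every fixed path \<open>V\<close> the set of those \<open>a\<close> is null for which
  \<open>g a = F (V + \<Sum>b. (a \<bullet> b) H b)\<close> lies in \<open>N\<close> and \<open>g\<close> has an invertible derivative at \<open>a\<close>. Near
  such points \<open>g\<close> has a locally Lipschitz inverse, and Lipschitz images of null sets are null.
  Finally, nondegeneracy of the Malliavin matrix (with the Riesz representation of the functionals
  \<open>x \<mapsto> \<iota> (\<pi> x) \<bullet> \<eta>\<close>) and continuity of the Jacobian in time show that, for almost every path,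
  one of these countably many choices of cells makes the derivative invertible.
\<close>

text \<open>The proof uses only the derivative of \<open>g\<close> at each single point; a lower
  bound for it there takes the place of an inverse function theorem. The cells that make the
  derivative invertible depend on the path, whereas resampling needs them fixed in advance. So the
  cells are held fixed, the event to be shown null also demands that they work at the path itself,
  and the union over all choices is formed only at the end. Subtracting the increments before adding
  the Gaussian vector makes the law exactly invariant, so that neither a Girsanov density nor a
  disintegration of Wiener measure enters. Since Wiener measure is given through characteristic
  functions, this invariance rests on their determining a measure on paths, which is reduced to
  Levy's theorem on the real line. Measurability of the solution in the path has to be derived from
  its sequential continuity.\<close>

section \<open>Integration and Riesz representation in Hilbert spaces, null sets\<close>

text \<open>The library states the next two facts for class \<open>banach\<close> only, which the sort
  \<open>{real_inner, complete_space}\<close> does not entail. Testing Riemann sums against unit vectors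
  reduces the first one to real-valued integrands.\<close>

lemma integrable_continuous_inner:
  fixes f :: "real \<Rightarrow> 'a::{real_inner,complete_space}"
  assumes f: "continuous_on {a..b} f"
  shows "f integrable_on {a..b}"
proof -
  have "\<exists>\<gamma>. gauge \<gamma> \<and>
          (\<forall>\<D>1 \<D>2. \<D>1 tagged_division_of (cbox a b) \<and> \<gamma> fine \<D>1 \<and>
            \<D>2 tagged_division_of (cbox a b) \<and> \<gamma> fine \<D>2 \<longrightarrow>
            norm ((\<Sum>(x,K)\<in>\<D>1. measure lborel K *\<^sub>R f x) - (\<Sum>(x,K)\<in>\<D>2. measure lborel K *\<^sub>R f x)) < e)"
    if e: "e > 0" for e
  proof -
    define c where "c = measure lborel (cbox a b)"
    have c0: "c \<ge> 0" unfolding c_def by simp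
    \<comment> \<open>Each Riemann sum will cost at most \<open>e' * c\<close>, and
      \<open>2 * (e' * c) < e\<close>; the 1 added to \<open>c\<close> covers an interval of length
      zero.\<close>
    define e' where "e' = e / (3 * (c + 1))"
    have e'0: "e' > 0" unfolding e'_def using e c0 by simp
    have e'c: "2 * (e' * c) < e"
      unfolding e'_def using e c0 by (simp add: field_simps add_nonneg_pos)
    obtain d where d: "d > 0" and du: "\<And>x y. x \<in> {a..b} \<Longrightarrow> y \<in> {a..b} \<Longrightarrow> dist y x < d \<Longrightarrow> dist (f y) (f x) < e'"
      using compact_uniformly_continuous[OF f compact_Icc] e'0
      unfolding uniformly_continuous_on_def by metis
    define S where "S (D :: (real \<times> real set) set) = (\<Sum>(x,K)\<in>D. measure lborel K *\<^sub>R f x)" for D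
    have key: "\<bar>S D \<bullet> w - integral (cbox a b) (\<lambda>x. f x \<bullet> w)\<bar> \<le> e' * c * norm w"
      if D: "D tagged_division_of (cbox a b)" "(\<lambda>x. ball x d) fine D" for D w
    proof -
      have int: "(\<lambda>x. f x \<bullet> w) integrable_on cbox a b"
        using f by (intro integrable_continuous continuous_intros) (auto simp: cbox_interval)
      have "\<bar>S D \<bullet> w - integral (cbox a b) (\<lambda>x. f x \<bullet> w)\<bar>
          = \<bar>(\<Sum>(x,K)\<in>D. measure lborel K * (f x \<bullet> w) - integral K (\<lambda>x. f x \<bullet> w))\<bar>"
        unfolding S_def integral_combine_tagged_division_topdown[OF int D(1)]
        by (simp add: inner_sum_left sum_subtractf case_prod_unfold)
      also have "\<dots> \<le> (\<Sum>(x,K)\<in>D. \<bar>measure lborel K * (f x \<bullet> w) - integral K (\<lambda>x. f x \<bullet> w)\<bar>)"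
        by (rule order_trans[OF sum_abs]) (simp add: case_prod_unfold)
      also have "\<dots> \<le> (\<Sum>(x,K)\<in>D. measure lborel K * (e' * norm w))"
      proof (intro sum_mono, clarify)
        fix x K assume xK: "(x, K) \<in> D"
        obtain p q where K: "K = cbox p q" using tagged_division_ofD(4)[OF D(1) xK] by blast
        have sub: "K \<subseteq> cbox a b" "x \<in> K" using tagged_division_ofD(2,3)[OF D(1) xK] by auto
        have Kb: "K \<subseteq> ball x d" using D(2) xK by (auto simp: fine_def)
        have iK: "(\<lambda>x. f x \<bullet> w) integrable_on cbox p q"
          using integrable_on_subcbox[OF int] sub K by blast
        have hi: "((\<lambda>y. f x \<bullet> w - f y \<bullet> w) has_integral (measure lborel (cbox p q) * (f x \<bullet> w) - integral (cbox p q) (\<lambda>x. f x \<bullet> w))) (cbox p q)"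
          using has_integral_diff[OF has_integral_const[of "f x \<bullet> w" p q] integrable_integral[OF iK]] by simp
        have "norm (measure lborel (cbox p q) * (f x \<bullet> w) - integral (cbox p q) (\<lambda>x. f x \<bullet> w)) \<le> (e' * norm w) * measure lborel (cbox p q)"
        proof (rule has_integral_bound[OF _ hi])
          show "0 \<le> e' * norm w" using e'0 by simp
          fix y assume y: "y \<in> cbox p q"
          have "norm (f x \<bullet> w - f y \<bullet> w) \<le> norm (f x - f y) * norm w"
            by (metis inner_diff_left Cauchy_Schwarz_ineq2 real_norm_def)
          also have "norm (f x - f y) \<le> e'"
          proof -
            have "dist y x < d" using y Kb K by (auto simp: dist_commute)
            moreover have "x \<in> {a..b}" "y \<in> {a..b}" using sub y K by (auto simp: cbox_interval)
            ultimately show ?thesis using du[of x y] by (simp add: dist_norm norm_minus_commute)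
          qed
          finally show "norm (f x \<bullet> w - f y \<bullet> w) \<le> e' * norm w" by (simp add: mult_right_mono)
        qed
        then show "\<bar>measure lborel K * (f x \<bullet> w) - integral K (\<lambda>x. f x \<bullet> w)\<bar> \<le> measure lborel K * (e' * norm w)"
          by (simp add: K mult_ac)
      qed
      also have "\<dots> = e' * norm w * c"
        using additive_content_tagged_division[OF D(1)]
        by (simp add: c_def case_prod_unfold flip: sum_distrib_right)
      finally show ?thesis by (simp add: mult_ac)
    qed
    have "norm (S D1 - S D2) < e"
      if D: "D1 tagged_division_of (cbox a b)" "(\<lambda>x. ball x d) fine D1"
        "D2 tagged_division_of (cbox a b)" "(\<lambda>x. ball x d) fine D2" for D1 D2
    proof -
      \<comment> \<open>Paired with their own difference \<open>v\<close>, both sums are within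
        \<open>e' * c * norm v\<close> of the same real integral, so no vector-valued integral is
        presupposed.\<close>
      define v where "v = S D1 - S D2"
      have "norm v * norm v = S D1 \<bullet> v - S D2 \<bullet> v"
        unfolding v_def by (simp add: inner_diff_left[symmetric] power2_norm_eq_inner[symmetric] power2_eq_square)
      also have "\<dots> \<le> 2 * (e' * c) * norm v"
        using key[OF D(1,2), of v] key[OF D(3,4), of v] by linarith
      finally have "norm v \<le> 2 * (e' * c)"
        using e'0 c0 by (cases "v = 0") auto
      then show ?thesis using e'c v_def by simp
    qed
    then show ?thesis
      unfolding S_def using d by (intro exI[of _ "\<lambda>x. ball x d"]) (auto simp: gauge_ball)
  qed
  then show ?thesis by (simp only: integrable_Cauchy flip: cbox_interval) blast
qed

lemma has_integral_restrict_interval: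
  fixes f :: "real \<Rightarrow> 'a::real_normed_vector"
  assumes f: "(f has_integral y) {p..q}" and "a \<le> p" "p \<le> q" "q \<le> b"
  shows "((\<lambda>s. if s \<in> {p..q} then f s else 0) has_integral y) {a..b}"
proof -
  let ?g = "\<lambda>s. if s \<in> {p..q} then f s else 0"
  have combine: "(?g has_integral (i + j)) {a'..b'}"
    if "(?g has_integral i) {a'..c}" "(?g has_integral j) {c..b'}" "a' \<le> c" "c \<le> b'" for i j a' b' c
  proof -
    have "cbox a' b' \<inter> {x. x \<bullet> 1 \<le> c} = {a'..c}" "cbox a' b' \<inter> {x. c \<le> x \<bullet> 1} = {c..b'}"
      using that by (auto simp: cbox_interval)
    then show ?thesis using has_integral_split[of ?g i a' b' 1 c j] that by (simp add: cbox_interval)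
  qed
  have zero: "(?g has_integral 0) {c..d}" if "d \<le> p \<or> q \<le> c" for c d
    by (rule has_integral_spike_finite[of "{p, q}" _ _ "\<lambda>_. 0"]) (use that in auto)
  have "(?g has_integral y) {p..q}" using f by (rule has_integral_eq[rotated]) simp
  then have "(?g has_integral (0 + (y + 0))) {a..b}"
    using assms by (intro combine[of _ _ p] combine[of _ _ q] zero) auto
  then show ?thesis by simp
qed

text \<open>For the vector \<open>z\<close> sought, \<open>x \<bullet> x - 2 * l x\<close> is the
  squared distance from \<open>x\<close> to \<open>z\<close> up to a constant. So \<open>z\<close>
  is found as a minimiser, and the parallelogram identity makes a minimising sequence
  Cauchy.\<close>

lemma Riesz_representation:
  fixes l :: "'a::{real_inner,complete_space} \<Rightarrow> real"
  assumes "bounded_linear l"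
  obtains z where "\<And>x. l x = x \<bullet> z"
proof -
  interpret bounded_linear l by fact
  define q where "q x = x \<bullet> x - 2 * l x" for x
  obtain K where K: "\<And>x. \<bar>l x\<bar> \<le> norm x * K" using bounded by auto
  have qlow: "q x \<ge> - (K\<^sup>2)" for x
  proof -
    have "0 \<le> (norm x - K)\<^sup>2" by simp
    then show ?thesis using K[of x] unfolding q_def
      by (simp add: power2_diff power2_norm_eq_inner[symmetric])
  qed
  then have bdd: "bdd_below (range q)" by (intro bdd_belowI[of _ "-(K\<^sup>2)"]) auto
  define m where "m = (INF x. q x)"
  have m: "m \<le> q x" for x unfolding m_def using bdd by (rule cINF_lower) simp
  have "\<exists>x. q x < m + 1 / real (Suc n)" for n
    using cINF_less_iff[OF _ bdd, of "m + 1 / real (Suc n)"] by (auto simp: m_def)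
  then obtain X where X: "\<And>n. q (X n) < m + 1 / real (Suc n)" by metis
  have par: "(norm (x - y))\<^sup>2 \<le> 2 * q x + 2 * q y - 4 * m" for x y
  proof -
    have "(norm (x - y))\<^sup>2 = 2 * q x + 2 * q y - 4 * q ((1/2) *\<^sub>R (x + y))"
      unfolding q_def power2_norm_eq_inner
      by (simp add: inner_simps inner_commute add scale field_simps)
    then show ?thesis using m[of "(1/2) *\<^sub>R (x + y)"] by linarith
  qed
  have "Cauchy X"
  proof (rule metric_CauchyI)
    fix e :: real assume e: "e > 0"
    obtain N where N: "1 / real (Suc N) < e\<^sup>2 / 4"
      using reals_Archimedean[of "e\<^sup>2/4"] e by (auto simp: inverse_eq_divide)
    have "dist (X i) (X j) < e" if "i \<ge> N" "j \<ge> N" for i j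
    proof -
      have "1 / real (Suc i) \<le> 1 / real (Suc N)" "1 / real (Suc j) \<le> 1 / real (Suc N)"
        using that by (auto simp: field_simps)
      then have "(norm (X i - X j))\<^sup>2 < e\<^sup>2" using par[of "X i" "X j"] X[of i] X[of j] N by linarith
      then show ?thesis using e by (simp add: dist_norm power2_less_imp_less)
    qed
    then show "\<exists>M. \<forall>i\<ge>M. \<forall>j\<ge>M. dist (X i) (X j) < e" by blast
  qed
  then obtain z where z: "X \<longlonglongrightarrow> z" using Cauchy_convergent convergent_def by blast
  have "(\<lambda>n. q (X n)) \<longlonglongrightarrow> q z"
    unfolding q_def by (intro tendsto_intros z tendsto)
  moreover have "(\<lambda>n. m + 1 / real (Suc n)) \<longlonglongrightarrow> m + 0"
    by (intro tendsto_intros LIMSEQ_Suc lim_1_over_n)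
  ultimately have "q z \<le> m + 0"
    by (rule LIMSEQ_le) (use X less_imp_le in blast)
  then have zmin: "q z \<le> q x" for x using m[of x] by simp
  have "l x = x \<bullet> z" for x
  proof (cases "x = 0")
    case False
    define r where "r = x \<bullet> z - l x"
    \<comment> \<open>This \<open>s\<close> minimises \<open>q\<close> on the line through
      \<open>z\<close> in direction \<open>x\<close>; the gain contradicts minimality unless
      \<open>r = 0\<close>.\<close>
    define s where "s = - r / (x \<bullet> x)"
    have xx: "x \<bullet> x > 0" using False by simp
    have "q (z + s *\<^sub>R x) = q z + 2 * s * r + s\<^sup>2 * (x \<bullet> x)"
      unfolding q_def r_def by (simp add: inner_simps inner_commute add scale algebra_simps power2_eq_square)
    also have "\<dots> = q z - r\<^sup>2 / (x \<bullet> x)"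
      unfolding s_def using xx by (simp add: power2_eq_square field_simps)
    finally have "r\<^sup>2 / (x \<bullet> x) \<le> 0" using zmin[of "z + s *\<^sub>R x"] by linarith
    then have "r = 0" using xx by (simp add: divide_le_0_iff)
    then show ?thesis by (simp add: r_def)
  qed (simp add: zero)
  then show ?thesis using that by blast
qed

section \<open>Null sets under maps with nonsingular derivative\<close>

text \<open>The derivative bounds increments of \<open>g\<close> from below, with a constant and a
  radius that vary with the point. Countably many sets \<open>R n\<close> make both uniform; on a
  small piece of one, \<open>g\<close> is injective with a Lipschitz inverse, which carries nullity
  back from \<open>N\<close>.\<close>

lemma negligible_vimage_nonsingular:
  fixes g :: "'m::euclidean_space \<Rightarrow> 'm"
  assumes g: "\<And>a. a \<in> S \<Longrightarrow> (g has_derivative g' a) (at a)"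
    and low: "\<And>a. a \<in> S \<Longrightarrow> \<exists>c>0. \<forall>d. norm (g' a d) \<ge> c * norm d"
    and N: "negligible N" "g ` S \<subseteq> N"
  shows "negligible S"
proof -
  \<comment> \<open>One index serves as reciprocal radius and as Lipschitz constant of the
    inverse.\<close>
  define R where "R n = {a \<in> S. \<forall>b. norm (b - a) < 1 / real (Suc n) \<longrightarrow> norm (b - a) \<le> real (Suc n) * norm (g b - g a)}" for n
  have "S \<subseteq> (\<Union>n. R n)"
  proof
    fix a assume a: "a \<in> S"
    obtain c where c: "c > 0" "\<And>d. norm (g' a d) \<ge> c * norm d" using low[OF a] by blast
    \<comment> \<open>An error of at most \<open>c / 2\<close> leaves \<open>c / 2\<close> for the
      lower bound on increments.\<close>
    obtain \<delta> where \<delta>: "\<delta> > 0" "\<And>b. norm (b - a) < \<delta> \<Longrightarrow> norm (g b - g a - g' a (b - a)) \<le> c/2 * norm (b - a)"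
      using g[OF a] c(1) unfolding has_derivative_at_alt by (meson half_gt_zero)
    obtain n1 where n1: "1 / real (Suc n1) < \<delta>" using reals_Archimedean[OF \<delta>(1)] by (auto simp: inverse_eq_divide)
    obtain n2 where n2: "1 / real (Suc n2) < c / 2" using reals_Archimedean[of "c/2"] c by (auto simp: inverse_eq_divide)
    define n where "n = max n1 n2"
    have "1 / real (Suc n) \<le> 1 / real (Suc n1)" "1 / real (Suc n) \<le> 1 / real (Suc n2)"
      unfolding n_def by (intro divide_left_mono; simp)+
    with n1 n2 have n: "1 / real (Suc n) < \<delta>" "1 / real (Suc n) < c/2" by linarith+
    have "norm (b - a) \<le> real (Suc n) * norm (g b - g a)" if "norm (b - a) < 1 / real (Suc n)" for b
    proof -
      have "norm (g' a (b - a)) \<le> norm (g b - g a) + norm (g b - g a - g' a (b - a))"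
        using norm_triangle_ineq4[of "g b - g a" "g b - g a - g' a (b - a)"] by simp
      then have "c * norm (b - a) \<le> norm (g b - g a) + c/2 * norm (b - a)"
        using c(2)[of "b - a"] \<delta>(2)[of b] that n by force
      then have "c / 2 * norm (b - a) \<le> norm (g b - g a)" by (simp add: field_simps)
      moreover have "1 / real (Suc n) * norm (b - a) \<le> c/2 * norm (b - a)"
        using n(2) by (intro mult_right_mono) auto
      ultimately have "1 / real (Suc n) * norm (b - a) \<le> norm (g b - g a)" by linarith
      then show ?thesis by (simp add: field_simps)
    qed
    then show "a \<in> (\<Union>n. R n)" using a unfolding R_def by blast
  qed
  moreover have "negligible (R n)" for n
  proof -
    \<comment> \<open>With half the radius of \<open>R n\<close>, any two points of the piece are
      close enough to each other.\<close>
    have "negligible (R n \<inter> ball x (1 / (2 * real (Suc n))))" for x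
    proof -
      let ?B = "R n \<inter> ball x (1 / (2 * real (Suc n)))"
      have lip: "norm (b - a) \<le> real (Suc n) * norm (g b - g a)" if "a \<in> ?B" "b \<in> ?B" for a b
      proof -
        have "dist b a < 1 / (2 * real (Suc n)) + 1 / (2 * real (Suc n))"
          using that dist_triangle_less_add[of x b "1 / (2 * real (Suc n))" a "1 / (2 * real (Suc n))"] 
          by (smt (verit, best) IntE dist_commute dist_triangle mem_ball)
        then have "norm (b - a) < 1 / real (Suc n)" by (simp add: dist_norm field_simps)
        then show ?thesis using that unfolding R_def by blast
      qed
      have inj: "inj_on g ?B" using lip by (force intro: inj_onI)
      have "negligible (the_inv_into ?B g ` (g ` ?B))"
      proof (rule negligible_locally_Lipschitz_image)
        show "negligible (g ` ?B)" by (rule negligible_subset[OF N(1)]) (use N(2) in \<open>auto simp: R_def\<close>)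
        fix y assume "y \<in> g ` ?B"
        then show "\<exists>T B. open T \<and> y \<in> T \<and> (\<forall>z\<in>g ` ?B \<inter> T. norm (the_inv_into ?B g z - the_inv_into ?B g y) \<le> B * norm (z - y))"
          using lip by (intro exI[of _ UNIV] exI[of _ "real (Suc n)"]) (auto simp: the_inv_into_f_f[OF inj] simp del: of_nat_Suc)
      qed simp
      then show ?thesis using the_inv_into_onto[OF inj] by simp
    qed
    then show ?thesis
      unfolding negligible_iff_null_sets[symmetric]
      by (intro locally_negligible_alt[THEN iffD2] ballI)
         (metis Int_iff Int_commute centre_in_ball divide_pos_pos inf_le1 mult_pos_pos of_nat_0_less_iff open_ball openin_open_Int zero_less_Suc zero_less_numeral zero_less_one)
  qed
  ultimately show ?thesis
    by (meson negligible_Union_nat negligible_subset)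
qed

section \<open>Coordinates on the range of the projection\<close>

text \<open>On all of \<open>'x\<close> the linear map \<iota> may be discontinuous. On the range of
  \<pi> it has a linear inverse \<open>j\<close> defined on Euclidean space, and compactness of the
  unit sphere bounds \<open>j\<close> below; read backwards, this bounds \<iota> on that
  range.\<close>

lemma bounded_linear_finite_range:
  fixes \<iota> :: "'x::real_normed_vector \<Rightarrow> 'm::euclidean_space"
  assumes \<pi>: "bounded_linear \<pi>" and \<iota>: "linear \<iota>" and bij: "bij_betw \<iota> (range \<pi>) UNIV"
  shows "bounded_linear (\<lambda>x. \<iota> (\<pi> x))"
proof -
  interpret \<pi>: bounded_linear \<pi> by fact
  interpret \<iota>: linear \<iota> by fact
  define j where "j = the_inv_into (range \<pi>) \<iota>"
  have inj: "inj_on \<iota> (range \<pi>)" using bij by (simp add: bij_betw_def)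
  have jr: "j y \<in> range \<pi>" "\<iota> (j y) = y" for y
    using bij the_inv_into_into[OF inj, of y "range \<pi>"] f_the_inv_into_f_bij_betw[OF bij, of y]
    unfolding j_def bij_betw_def by auto
  have ji: "j (\<iota> (\<pi> x)) = \<pi> x" for x unfolding j_def using the_inv_into_f_f[OF inj] by simp
  have "linear j"
  proof (rule linearI)
    fix x y :: 'm and c :: real
    obtain p q where p: "j x = \<pi> p" "j y = \<pi> q" using jr(1) by blast
    have "j (x + y) = j (\<iota> (\<pi> (p + q)))" using jr(2)[of x] jr(2)[of y] p by (simp add: \<pi>.add \<iota>.add)
    then show "j (x + y) = j x + j y" using ji[of "p + q"] p by (simp add: \<pi>.add)
    have "j (c *\<^sub>R x) = j (\<iota> (\<pi> (c *\<^sub>R p)))" using jr(2)[of x] p by (simp add: \<pi>.scale \<iota>.scale)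
    then show "j (c *\<^sub>R x) = c *\<^sub>R j x" using ji[of "c *\<^sub>R p"] p by (simp add: \<pi>.scale)
  qed
  then have jbl: "bounded_linear j" by (simp add: linear_conv_bounded_linear)
  have cont: "continuous_on (sphere 0 1) (\<lambda>y. norm (j y))"
    by (intro continuous_intros bounded_linear.continuous_on[OF jbl])
  obtain y0 where y0: "y0 \<in> sphere 0 1" "\<And>y. y \<in> sphere 0 1 \<Longrightarrow> norm (j y0) \<le> norm (j y)"
    using continuous_attains_inf[OF compact_sphere _ cont] by (metis SOME_Basis dist_0_norm empty_iff mem_sphere norm_Basis)
  define c where "c = norm (j y0)"
  have "j y0 \<noteq> 0" using y0(1) jr(2)[of y0] \<iota>.zero by auto
  then have c: "c > 0" by (simp add: c_def)
  interpret j: bounded_linear j by (rule jbl)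
  have low: "c * norm y \<le> norm (j y)" for y
  proof (cases "y = 0")
    case False
    have "c \<le> norm (j ((1 / norm y) *\<^sub>R y))" unfolding c_def by (rule y0(2)) (use False in simp)
    then show ?thesis using False by (simp add: j.scale field_simps)
  qed simp
  obtain K where K: "\<And>x. norm (\<pi> x) \<le> norm x * K" using \<pi>.bounded by blast
  show ?thesis
  proof (rule bounded_linear_intro[where K = "K / c"])
    fix x show "norm (\<iota> (\<pi> x)) \<le> norm x * (K / c)"
      using low[of "\<iota> (\<pi> x)"] K[of x] c by (simp add: ji field_simps)
  qed (simp_all add: \<pi>.add \<iota>.add \<pi>.scale \<iota>.scale)
qed

section \<open>Spanning families from averages over a grid\<close>

text \<open>Rolle's theorem for the primitive. It replaces a vanishing average over a cell by a
  vanishing value inside it.\<close>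

lemma integral_zero_imp_root:
  fixes f :: "real \<Rightarrow> real"
  assumes "a < b" and f: "continuous_on {a..b} f" and "integral {a..b} f = 0"
  obtains z where "z \<in> {a..b}" "f z = 0"
proof -
  define F where "F x = integral {a..x} f" for x
  have der: "(F has_real_derivative f x) (at x within {a..b})" if "x \<in> {a..b}" for x
    unfolding F_def using integral_has_real_derivative[OF f that] .
  have "\<exists>z. a < z \<and> z < b \<and> (\<lambda>h. f z * h) = (\<lambda>v. 0)"
  proof (rule Rolle_deriv[OF \<open>a < b\<close>])
    show "F a = F b" using assms by (simp add: F_def)
    show "continuous_on {a..b} F" using der by (rule DERIV_continuous_on)
    fix x assume x: "a < x" "x < b"
    then show "(F has_derivative (\<lambda>h. f x * h)) (at x)"
      using der[of x] at_within_Icc_at[of a x b] by (simp add: has_field_derivative_def)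
  qed
  then obtain z where "a < z" "z < b" "f z * 1 = 0" by metis
  then show ?thesis by (intro that[of z]) auto
qed

text \<open>A continuous family whose values are orthogonal to no nonzero vector already spans after
  averaging over a sufficiently fine grid: normals to the spans of the averages would accumulate
  at a vector orthogonal to all values.\<close>

lemma grid_averages_span:
  fixes v :: "'z \<Rightarrow> real \<Rightarrow> 'm::euclidean_space"
  assumes t: "t > 0" and v: "\<And>k. continuous_on {0..t} (v k)"
    and nd: "\<And>\<eta>. (\<And>k s. s \<in> {0..t} \<Longrightarrow> v k s \<bullet> \<eta> = 0) \<Longrightarrow> \<eta> = 0"
  obtains n :: nat where "n > 0"
    "span {integral {real j * (t / n)..real j * (t / n) + t / n} (v k) | j k. j < n} = UNIV"
proof -
  define A where "A n j k = integral {real j * (t / n)..real j * (t / n) + t / n} (v k)" for n j :: nat and k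
  define S where "S n = {A n j k | j k. j < n}" for n
  have "\<exists>n>0. span (S n) = UNIV"
  proof (rule ccontr)
    assume *: "\<not> (\<exists>n>0. span (S n) = UNIV)"
    \<comment> \<open>A proper subspace has a unit normal; \<open>Suc n\<close> keeps the number of
      cells positive.\<close>
    have "\<exists>\<eta>. norm \<eta> = 1 \<and> (\<forall>j k. j < Suc n \<longrightarrow> \<eta> \<bullet> A (Suc n) j k = 0)" for n
    proof -
      have "span (S (Suc n)) \<noteq> UNIV" using * by blast
      then obtain a where a: "a \<noteq> 0" "\<forall>x\<in>span (S (Suc n)). a \<bullet> x = 0"
        using span_not_UNIV_orthogonal by blast
      have "a \<bullet> A (Suc n) j k = 0" if "j < Suc n" for j k
        using a(2) span_base[of "A (Suc n) j k" "S (Suc n)"] that unfolding S_def by blast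
      then show ?thesis using a(1) by (intro exI[of _ "a /\<^sub>R norm a"]) auto
    qed
    then have "\<forall>n. \<exists>\<eta>. norm \<eta> = 1 \<and> (\<forall>j k. j < Suc n \<longrightarrow> \<eta> \<bullet> A (Suc n) j k = 0)" by blast
    from choice[OF this] obtain \<eta> where \<eta>1: "\<And>n. norm (\<eta> n) = 1"
      and \<eta>2: "\<And>n j k. j < Suc n \<Longrightarrow> \<eta> n \<bullet> A (Suc n) j k = 0" by blast
    have "\<forall>n. \<eta> n \<in> sphere 0 1" using \<eta>1 by simp
    then obtain e r where e: "e \<in> sphere 0 1" and r: "strict_mono (r :: nat \<Rightarrow> nat)" "(\<eta> \<circ> r) \<longlonglongrightarrow> e"
      using compact_sphere[of 0 1] unfolding compact_def by metis
    have "v k s \<bullet> e = 0" if s: "s \<in> {0..t}" for k s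
    proof -
      \<comment> \<open>The average over the cell containing \<open>s\<close> is orthogonal to
        \<open>\<eta> n\<close>, so the scalar product with \<open>\<eta> n\<close> has a root
        within one cell length of \<open>s\<close>. Along the subsequence the roots tend to
        \<open>s\<close> and the normals to \<open>e\<close>.\<close>
      have "\<exists>z. z \<in> {0..t} \<and> \<bar>z - s\<bar> \<le> t / real (Suc n) \<and> v k z \<bullet> \<eta> n = 0" for n
      proof -
        define \<delta> where "\<delta> = t / real (Suc n)"
        have \<delta>: "\<delta> > 0" using t by (simp add: \<delta>_def)
        have n\<delta>: "real (Suc n) * \<delta> = t" by (simp add: \<delta>_def)
        \<comment> \<open>The minimum matters only at \<open>s = t\<close>, where the floor would
          name a cell beyond the last one.\<close>
        define j where "j = min n (nat \<lfloor>s / \<delta>\<rfloor>)"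
        have j: "j < Suc n" by (simp add: j_def)
        have fl: "real (nat \<lfloor>s / \<delta>\<rfloor>) \<le> s / \<delta>" "s / \<delta> < real (nat \<lfloor>s / \<delta>\<rfloor>) + 1"
          using s \<delta> by auto
        have s1: "real j * \<delta> \<le> s"
        proof -
          have "real j \<le> s / \<delta>" using fl(1) by (simp add: j_def)
          then show ?thesis using \<delta> by (simp add: field_simps)
        qed
        have s2: "s \<le> real j * \<delta> + \<delta>"
        proof (cases "nat \<lfloor>s / \<delta>\<rfloor> \<le> n")
          case True
          then have "s / \<delta> \<le> real j + 1" using fl(2) by (simp add: j_def)
          then show ?thesis using \<delta> by (simp add: field_simps)
        next
          case False
          then have "j = n" by (simp add: j_def)
          then show ?thesis using s n\<delta> by (simp add: algebra_simps)
        qed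
        have jt: "real j * \<delta> + \<delta> \<le> t"
        proof -
          have "real (Suc j) * \<delta> \<le> real (Suc n) * \<delta>" using j \<delta> by (intro mult_right_mono) auto
          then show ?thesis using n\<delta> by (simp add: algebra_simps)
        qed
        have sub: "{real j * \<delta>..real j * \<delta> + \<delta>} \<subseteq> {0..t}" using jt \<delta> by auto
        have cont: "continuous_on {real j * \<delta>..real j * \<delta> + \<delta>} (v k)"
          using v sub by (rule continuous_on_subset)
        have "v k integrable_on {real j * \<delta>..real j * \<delta> + \<delta>}"
          by (rule integrable_continuous_interval[OF cont])
        then have "integral {real j * \<delta>..real j * \<delta> + \<delta>} (\<lambda>s. v k s \<bullet> \<eta> n) = integral {real j * \<delta>..real j * \<delta> + \<delta>} (v k) \<bullet> \<eta> n"
          using integral_linear[OF _ bounded_linear_inner_left[of "\<eta> n"]] by (simp add: comp_def)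
        also have "\<dots> = 0" using \<eta>2[OF j, of k] by (simp add: A_def \<delta>_def inner_commute)
        finally have int0: "integral {real j * \<delta>..real j * \<delta> + \<delta>} (\<lambda>s. v k s \<bullet> \<eta> n) = 0" .
        have "continuous_on {real j * \<delta>..real j * \<delta> + \<delta>} (\<lambda>s. v k s \<bullet> \<eta> n)"
          by (intro continuous_intros cont)
        then obtain z where "z \<in> {real j * \<delta>..real j * \<delta> + \<delta>}" "v k z \<bullet> \<eta> n = 0"
          using integral_zero_imp_root[OF _ _ int0] \<delta> by auto
        moreover from this have "z \<in> {0..t}" using sub by blast
        ultimately show ?thesis using s1 s2 unfolding \<delta>_def[symmetric] by (intro exI[of _ z]) auto
      qed
      then have "\<forall>n. \<exists>z. z \<in> {0..t} \<and> \<bar>z - s\<bar> \<le> t / real (Suc n) \<and> v k z \<bullet> \<eta> n = 0" by blast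
      from choice[OF this] obtain z where z: "\<And>n. z n \<in> {0..t}" "\<And>n. \<bar>z n - s\<bar> \<le> t / real (Suc n)"
        "\<And>n. v k (z n) \<bullet> \<eta> n = 0" by blast
      have "(\<lambda>n. t * (1 / real (Suc n))) \<longlonglongrightarrow> t * 0"
        by (intro tendsto_intros LIMSEQ_Suc lim_1_over_n)
      then have "(\<lambda>n. z n - s) \<longlonglongrightarrow> 0"
        using z(2) by (intro Lim_null_comparison[of "\<lambda>n. z n - s" "\<lambda>n. t * (1 / real (Suc n))"]) auto
      then have "z \<longlonglongrightarrow> s" by (simp add: LIM_zero_iff)
      then have "(z \<circ> r) \<longlonglongrightarrow> s" using r(1) by (rule LIMSEQ_subseq_LIMSEQ)
      then have "(\<lambda>n. v k ((z \<circ> r) n)) \<longlonglongrightarrow> v k s"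
        using continuous_on_tendsto_compose[OF v, of "z \<circ> r" s sequentially k] s z(1) by simp
      then have "(\<lambda>n. v k ((z \<circ> r) n) \<bullet> (\<eta> \<circ> r) n) \<longlonglongrightarrow> v k s \<bullet> e"
        by (intro tendsto_inner r(2))
      moreover have "(\<lambda>n. v k ((z \<circ> r) n) \<bullet> (\<eta> \<circ> r) n) = (\<lambda>_. 0)" by (simp add: z(3) fun_eq_iff)
      ultimately show ?thesis by (simp add: LIMSEQ_const_iff)
    qed
    then have "e = 0" by (intro nd)
    then show False using e by simp
  qed
  then show ?thesis using that unfolding S_def A_def by blast
qed

text \<open>The linear map taking the standard basis to a basis extracted from \<open>S\<close> is
  onto, hence injective, hence bounded below by some \<kappa>. Such a bound is the form in which
  invertibility of the derivative is tested.\<close>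

lemma spanning_set_imp_frame:
  fixes S :: "'m::euclidean_space set"
  assumes "span S = UNIV"
  obtains e :: "'m \<Rightarrow> 'm" and \<kappa> :: real where "inj_on e Basis" "e ` Basis \<subseteq> S" "\<kappa> > 0"
    "\<And>d. norm (\<Sum>b\<in>Basis. (d \<bullet> b) *\<^sub>R e b) \<ge> \<kappa> * norm d"
proof -
  obtain B where B: "B \<subseteq> S" "independent B" "S \<subseteq> span B"
    using maximal_independent_subset by blast
  have spB: "span B = UNIV" using assms B(3) span_mono[OF B(3)] by (simp add: span_span top_unique)
  have fB: "finite B" using B(2) by (rule independent_imp_finite)
  have "dim (UNIV :: 'm set) = card B"
    by (rule dim_unique[OF _ _ B(2) refl]) (use spB in auto)
  moreover have "dim (UNIV :: 'm set) = DIM('m)"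
    by (rule dim_unique[OF _ _ independent_Basis refl]) (auto simp: span_Basis)
  ultimately have "card B = DIM('m)" by (rule trans[OF sym])
  then obtain e where e: "bij_betw e (Basis :: 'm set) B"
    using finite_same_card_bij[of "Basis :: 'm set" B] fB by auto
  define f where "f d = (\<Sum>b\<in>Basis. (d \<bullet> b) *\<^sub>R e b)" for d :: 'm
  have lin: "linear f" unfolding f_def
    by (intro bounded_linear.linear bounded_linear_sum bounded_linear_scaleR_const bounded_linear_inner_left)
  have "B \<subseteq> range f"
  proof
    fix y assume "y \<in> B"
    then obtain b where b: "b \<in> Basis" "y = e b" using e by (auto simp: bij_betw_def)
    have "f b = (\<Sum>b'\<in>Basis. if b' = b then e b else 0)"
      unfolding f_def using b(1) by (intro sum.cong) (auto simp: inner_Basis)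
    also have "\<dots> = y" using b by simp
    finally show "y \<in> range f" by blast
  qed
  moreover have "subspace (range f)" using lin by (intro linear_subspace_image subspace_UNIV)
  ultimately have "surj f" using span_minimal[of B "range f"] spB by blast
  then have "inj f" using linear_surjective_imp_injective[OF lin] by simp
  then obtain \<kappa> where "\<kappa> > 0" "\<And>d. \<kappa> * norm d \<le> norm (f d)"
    using linear_inj_bounded_below_pos[OF lin] by blast
  then show ?thesis using that[of e \<kappa>] e B(1) by (auto simp: bij_betw_def f_def)
qed

section \<open>Uniqueness for characteristic functions of finitely many variables\<close>

text \<open>Levy's theorem concerns probability laws; dividing by the mass \<open>m\<close> makes it
  available for the unnormalised measures that weighting and restriction produce.\<close>

lemma normalized_distr:
  fixes k :: "'a \<Rightarrow> real" and m :: real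
  assumes "finite_measure K" and k: "k \<in> borel_measurable K"
    and m: "measure K (space K) = m" "m > 0" and A: "A \<in> sets borel"
  defines "D \<equiv> distr (density K (\<lambda>_. ennreal (1 / m))) borel k"
  shows "real_distribution D"
    and "char D b = (1 / m) *\<^sub>R (\<integral>x. cis (b * k x) \<partial>K)"
    and "measure D A = (1 / m) * measure K {x \<in> space K. k x \<in> A}"
proof -
  interpret K: finite_measure K by fact
  note [measurable] = k A
  have "emeasure (density K (\<lambda>_. ennreal (1 / m))) (space K) = 1"
    using m by (simp add: emeasure_density_const K.emeasure_eq_measure flip: ennreal_mult)
  then have "prob_space (density K (\<lambda>_. ennreal (1 / m)))" by (intro prob_spaceI) simp
  then interpret D: prob_space "density K (\<lambda>_. ennreal (1 / m))" .
  show "real_distribution D"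
    unfolding D_def by (simp add: real_distribution_def real_distribution_axioms_def D.prob_space_distr)
  show "char D b = (1 / m) *\<^sub>R (\<integral>x. cis (b * k x) \<partial>K)"
    unfolding char_def D_def using m
    by (subst integral_distr, simp, simp, subst integral_density)
       (auto simp: cis_conv_exp scaleR_conv_of_real mult.commute)
  show "measure D A = (1 / m) * measure K {x \<in> space K. k x \<in> A}"
    using m unfolding D_def measure_def
    by (subst emeasure_distr) (simp_all add: vimage_def Int_def conj_commute emeasure_density_const enn2real_mult)
qed

text \<open>Frequency 0 shows that the total masses agree; after normalisation Levy's theorem
  applies. Mass zero is separate because it cannot be normalised.\<close>

lemma measure_vimage_eq_if_char_eq:
  fixes f :: "'a \<Rightarrow> real" and g :: "'b \<Rightarrow> real"
  assumes "finite_measure M" "finite_measure N"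
    and f: "f \<in> borel_measurable M" and g: "g \<in> borel_measurable N"
    and eq: "\<And>b. (\<integral>x. cis (b * f x) \<partial>M) = (\<integral>x. cis (b * g x) \<partial>N)"
    and A: "A \<in> sets borel"
  shows "measure M {x \<in> space M. f x \<in> A} = measure N {x \<in> space N. g x \<in> A}"
proof -
  interpret M: finite_measure M by fact
  interpret N: finite_measure N by fact
  define m where "m = measure M (space M)"
  have "complex_of_real (measure M (space M)) = complex_of_real (measure N (space N))"
    using eq[of 0] by (simp add: scaleR_conv_of_real)
  then have m: "measure N (space N) = m" by (simp only: of_real_eq_iff m_def)
  show ?thesis
  proof (cases "m = 0")
    case True
    then have "measure M {x \<in> space M. f x \<in> A} \<le> 0" "measure N {x \<in> space N. g x \<in> A} \<le> 0"
      using M.bounded_measure[of "{x \<in> space M. f x \<in> A}"] N.bounded_measure[of "{x \<in> space N. g x \<in> A}"] m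
      by (auto simp: m_def)
    then show ?thesis using measure_nonneg by (metis order_antisym)
  next
    case False
    then have m0: "m > 0" using measure_nonneg[of M "space M"] by (simp add: m_def less_le)
    note M' = normalized_distr[OF assms(1) f m_def[symmetric] m0 A]
    note N' = normalized_distr[OF assms(2) g m m0 A]
    have "distr (density M (\<lambda>_. ennreal (1 / m))) borel f = distr (density N (\<lambda>_. ennreal (1 / m))) borel g"
      by (intro Levy_uniqueness M'(1) N'(1)) (simp add: fun_eq_iff M'(2) N'(2) eq)
    then have "(1 / m) * measure M {x \<in> space M. f x \<in> A} = (1 / m) * measure N {x \<in> space N. g x \<in> A}"
      using M'(3) N'(3) by metis
    then show ?thesis using m0 by simp
  qed
qed

text \<open>By Euler's formula the weight turns the characteristic function of \<open>f\<close> into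
  values of the joint one of \<open>f\<close> and \<open>\<psi>\<close> at second frequencies 0, 1
  and -1. The summand 1 keeps the density nonnegative, and the phase \<open>p\<close> gives the sine
  as well as the cosine. The coefficients stay explicit so that an equation for general frequencies
  rewrites every term.\<close>

lemma weighted_char:
  fixes f \<psi> :: "'a \<Rightarrow> real" and p b :: real
  assumes "finite_measure M" and f: "f \<in> borel_measurable M" and \<psi>: "\<psi> \<in> borel_measurable M"
    and A: "A \<in> sets borel"
  defines "K \<equiv> density M (\<lambda>x. ennreal (1 + cos (\<psi> x + p)))"
  shows "finite_measure K"
    and "(\<integral>x. cis (b * f x) \<partial>K) = (\<integral>x. cis (b * f x + 0 * \<psi> x) \<partial>M)
      + cis p / 2 * (\<integral>x. cis (b * f x + 1 * \<psi> x) \<partial>M) + cis (- p) / 2 * (\<integral>x. cis (b * f x + (- 1) * \<psi> x) \<partial>M)"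
    and "measure K {x \<in> space K. f x \<in> A}
      = (\<integral>x. indicator A (f x) \<partial>M) + (\<integral>x. indicator A (f x) * cos (\<psi> x + p) \<partial>M)"
proof -
  interpret M: finite_measure M by fact
  note [measurable] = f \<psi> A
  have nn: "0 \<le> 1 + cos y" for y :: real using cos_ge_minus_one[of y] by linarith
  have mc[measurable]: "cis \<in> borel_measurable borel"
    by (intro borel_measurable_continuous_onI continuous_intros)
  have ic: "integrable M (\<lambda>x. cis (h x))" if [measurable]: "h \<in> borel_measurable M" for h
    by (rule M.integrable_const_bound[where B = 1]) auto
  have ice: "integrable M (\<lambda>x. cis (b * f x + e * \<psi> x))" for e by (rule ic) measurable
  have il: "integrable M (\<lambda>x. 1 + cos (\<psi> x + p))"
    by (rule M.integrable_const_bound[where B = 2]) (auto intro!: AE_I2 order_trans[OF abs_triangle_ineq])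
  have "emeasure K (space K) = ennreal (\<integral>x. 1 + cos (\<psi> x + p) \<partial>M)"
    unfolding K_def using il nn
    by (simp add: emeasure_density nn_integral_eq_integral cong: nn_integral_cong)
  then show "finite_measure K" by (intro finite_measureI) simp
  have "(\<integral>x. cis (b * f x) \<partial>K) = (\<integral>x. (1 + cos (\<psi> x + p)) *\<^sub>R cis (b * f x) \<partial>M)"
    unfolding K_def by (intro integral_density) (auto simp: nn)
  also have "\<dots> = (\<integral>x. cis (b * f x + 0 * \<psi> x) + cis p / 2 * cis (b * f x + 1 * \<psi> x)
      + cis (- p) / 2 * cis (b * f x + (- 1) * \<psi> x) \<partial>M)"
  proof (intro Bochner_Integration.integral_cong refl)
    fix x
    have e1: "cis p * cis (b * f x + 1 * \<psi> x) = cis (b * f x) * cis (\<psi> x + p)"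
      by (simp add: cis_mult ac_simps)
    have e2: "cis (- p) * cis (b * f x + (- 1) * \<psi> x) = cis (b * f x) * cis (- (\<psi> x + p))"
      by (simp add: cis_mult algebra_simps)
    have "complex_of_real (cos y) = (cis y + cis (- y)) / 2" for y by (simp add: complex_eq_iff)
    from this[of "\<psi> x + p"] have c: "complex_of_real (cos (\<psi> x + p)) = (cis (\<psi> x + p) + cis (- (\<psi> x + p))) / 2" .
    have "(1 + cos (\<psi> x + p)) *\<^sub>R cis (b * f x) = cis (b * f x) + (cis (b * f x) * cis (\<psi> x + p)) / 2
        + (cis (b * f x) * cis (- (\<psi> x + p))) / 2"
      unfolding scaleR_conv_of_real of_real_add of_real_1 c
      by (simp add: distrib_right distrib_left add_divide_distrib mult.commute)
    then show "(1 + cos (\<psi> x + p)) *\<^sub>R cis (b * f x) = cis (b * f x + 0 * \<psi> x)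
        + cis p / 2 * cis (b * f x + 1 * \<psi> x) + cis (- p) / 2 * cis (b * f x + (- 1) * \<psi> x)"
      unfolding e1[symmetric] e2[symmetric] by simp
  qed
  also have "\<dots> = (\<integral>x. cis (b * f x + 0 * \<psi> x) \<partial>M)
      + cis p / 2 * (\<integral>x. cis (b * f x + 1 * \<psi> x) \<partial>M) + cis (- p) / 2 * (\<integral>x. cis (b * f x + (- 1) * \<psi> x) \<partial>M)"
    by (simp only: Bochner_Integration.integral_add Bochner_Integration.integrable_add integrable_mult_right
        ice integral_mult_right_zero)
  finally show "(\<integral>x. cis (b * f x) \<partial>K) = (\<integral>x. cis (b * f x + 0 * \<psi> x) \<partial>M)
      + cis p / 2 * (\<integral>x. cis (b * f x + 1 * \<psi> x) \<partial>M) + cis (- p) / 2 * (\<integral>x. cis (b * f x + (- 1) * \<psi> x) \<partial>M)" .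
  have i1: "integrable M (\<lambda>x. indicator A (f x) :: real)" "integrable M (\<lambda>x. indicator A (f x) * cos (\<psi> x + p) :: real)"
    by (rule M.integrable_const_bound[where B = 1], auto simp: indicator_def)+
  have "emeasure K {x \<in> space K. f x \<in> A} = (\<integral>\<^sup>+x. ennreal (indicator A (f x) + indicator A (f x) * cos (\<psi> x + p)) \<partial>M)"
    unfolding K_def by (subst emeasure_density) (auto intro!: nn_integral_cong simp: indicator_def)
  also have "\<dots> = ennreal (\<integral>x. indicator A (f x) + indicator A (f x) * cos (\<psi> x + p) \<partial>M)"
    by (intro nn_integral_eq_integral Bochner_Integration.integrable_add i1)
       (auto simp: indicator_def nn)
  also have "(\<integral>x. indicator A (f x) + indicator A (f x) * cos (\<psi> x + p) \<partial>M)
     = (\<integral>x. indicator A (f x) \<partial>M) + (\<integral>x. indicator A (f x) * cos (\<psi> x + p) \<partial>M)"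
    by (intro Bochner_Integration.integral_add i1)
  finally have *: "emeasure K {x \<in> space K. f x \<in> A}
     = ennreal ((\<integral>x. indicator A (f x) \<partial>M) + (\<integral>x. indicator A (f x) * cos (\<psi> x + p) \<partial>M))" .
  have "(\<integral>x. indicator A (f x) + indicator A (f x) * cos (\<psi> x + p) \<partial>M) \<ge> 0"
    by (intro integral_nonneg_AE AE_I2) (auto simp: indicator_def nn)
  then show "measure K {x \<in> space K. f x \<in> A}
      = (\<integral>x. indicator A (f x) \<partial>M) + (\<integral>x. indicator A (f x) * cos (\<psi> x + p) \<partial>M)"
    unfolding measure_def * using Bochner_Integration.integral_add[OF i1] by simp
qed

text \<open>Weighting by the nonnegative densities \<open>1 + cos \<psi>\<close> and \<open>1 + sin \<psi>\<close> reduces the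
  statement to the one-dimensional uniqueness theorem.\<close>

lemma restricted_char_eq:
  fixes f \<psi> :: "'a \<Rightarrow> real" and g \<kappa> :: "'b \<Rightarrow> real"
  assumes M: "finite_measure M" and N: "finite_measure N"
    and f: "f \<in> borel_measurable M" and \<psi>: "\<psi> \<in> borel_measurable M"
    and g: "g \<in> borel_measurable N" and \<kappa>: "\<kappa> \<in> borel_measurable N"
    and eq: "\<And>b e. (\<integral>x. cis (b * f x + e * \<psi> x) \<partial>M) = (\<integral>x. cis (b * g x + e * \<kappa> x) \<partial>N)"
    and A: "A \<in> sets borel"
  shows "(\<integral>x. indicator A (f x) *\<^sub>R cis (\<psi> x) \<partial>M) = (\<integral>x. indicator A (g x) *\<^sub>R cis (\<kappa> x) \<partial>N)"
proof -
  interpret M: finite_measure M by fact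
  interpret N: finite_measure N by fact
  note [measurable] = f \<psi> g \<kappa> A
  have "measure M {x \<in> space M. f x \<in> A} = measure N {x \<in> space N. g x \<in> A}"
    using eq[of _ 0] by (intro measure_vimage_eq_if_char_eq M N f g A) simp
  moreover have "(\<integral>x. indicator A (f x) \<partial>M) = (\<integral>x. indicator {x \<in> space M. f x \<in> A} x \<partial>M :: real)"
    by (intro Bochner_Integration.integral_cong refl) (simp add: indicator_def)
  moreover have "(\<integral>x. indicator A (g x) \<partial>N) = (\<integral>x. indicator {x \<in> space N. g x \<in> A} x \<partial>N :: real)"
    by (intro Bochner_Integration.integral_cong refl) (simp add: indicator_def)
  ultimately have 1: "(\<integral>x. indicator A (f x) \<partial>M) = ((\<integral>x. indicator A (g x) \<partial>N) :: real)" by (simp add: Int_def conj_commute)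
  have 2: "(\<integral>x. indicator A (f x) * cos (\<psi> x + p) \<partial>M) = (\<integral>x. indicator A (g x) * cos (\<kappa> x + p) \<partial>N)" for p
  proof -
    note M' = weighted_char[OF M f \<psi> A, where p = p]
    note N' = weighted_char[OF N g \<kappa> A, where p = p]
    have "measure (density M (\<lambda>x. ennreal (1 + cos (\<psi> x + p)))) {x \<in> space (density M (\<lambda>x. ennreal (1 + cos (\<psi> x + p)))). f x \<in> A}
      = measure (density N (\<lambda>x. ennreal (1 + cos (\<kappa> x + p)))) {x \<in> space (density N (\<lambda>x. ennreal (1 + cos (\<kappa> x + p)))). g x \<in> A}"
      using M'(1) N'(1) by (rule measure_vimage_eq_if_char_eq) (simp_all only: M'(2) N'(2) eq A, measurable)
    then show ?thesis unfolding M'(3) N'(3) 1 by simp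
  qed
  have mc[measurable]: "cis \<in> borel_measurable borel"
    by (intro borel_measurable_continuous_onI continuous_intros)
  have ic: "integrable M (\<lambda>x. indicator A (f x) *\<^sub>R cis (\<psi> x))" "integrable N (\<lambda>x. indicator A (g x) *\<^sub>R cis (\<kappa> x))"
    by (rule M.integrable_const_bound[where B = 1] N.integrable_const_bound[where B = 1], auto simp: indicator_def)+
  show ?thesis
  proof (rule complex_eqI)
    show "Re (\<integral>x. indicator A (f x) *\<^sub>R cis (\<psi> x) \<partial>M) = Re (\<integral>x. indicator A (g x) *\<^sub>R cis (\<kappa> x) \<partial>N)"
      using 2[of 0] by (simp add: integral_Re[OF ic(1), symmetric] integral_Re[OF ic(2), symmetric])
    \<comment> \<open>The phase \<open>- (pi/2)\<close> turns the cosine into the sine.\<close>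
    show "Im (\<integral>x. indicator A (f x) *\<^sub>R cis (\<psi> x) \<partial>M) = Im (\<integral>x. indicator A (g x) *\<^sub>R cis (\<kappa> x) \<partial>N)"
      using 2[of "- (pi/2)"] by (simp add: integral_Im[OF ic(1), symmetric] integral_Im[OF ic(2), symmetric] cos_diff)
  qed
qed

lemma emeasure_density_indicator:
  assumes [measurable]: "f \<in> borel_measurable M" "A \<in> sets borel" "{x \<in> space M. Q x} \<in> sets M"
  shows "emeasure (density M (\<lambda>x. ennreal (indicator A (f x)))) {x \<in> space M. Q x}
    = emeasure M {x \<in> space M. f x \<in> A \<and> Q x}"
proof -
  have "{x \<in> space M. f x \<in> A \<and> Q x} = {x \<in> space M. f x \<in> A} \<inter> {x \<in> space M. Q x}" by blast
  also have "\<dots> \<in> sets M" by measurable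
  finally have [measurable]: "{x \<in> space M. f x \<in> A \<and> Q x} \<in> sets M" .
  have "(\<integral>\<^sup>+x. ennreal (indicator A (f x)) * indicator {x \<in> space M. Q x} x \<partial>M)
    = (\<integral>\<^sup>+x. indicator {x \<in> space M. f x \<in> A \<and> Q x} x \<partial>M)"
    by (intro nn_integral_cong) (simp add: indicator_def)
  then show ?thesis by (subst emeasure_density) simp_all
qed

text \<open>In the induction the condition on one coordinate is absorbed into the measure as a
  density, which is why \<open>M\<close> and \<open>N\<close> vary and are merely finite. By
  \<open>restricted_char_eq\<close> the remaining coordinates keep equal characteristic functions
  under the restricted measures.\<close>

lemma measure_cylinder_eq_if_char_eq:
  fixes f :: "'i \<Rightarrow> 'a \<Rightarrow> real" and g :: "'i \<Rightarrow> 'b \<Rightarrow> real"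
  assumes "finite I" "finite_measure M" "finite_measure N"
    and "\<And>i. i \<in> I \<Longrightarrow> f i \<in> borel_measurable M" "\<And>i. i \<in> I \<Longrightarrow> g i \<in> borel_measurable N"
    and "\<And>i. i \<in> I \<Longrightarrow> A i \<in> sets borel"
    and "\<And>c. (\<integral>x. cis (\<Sum>i\<in>I. c i * f i x) \<partial>M) = (\<integral>x. cis (\<Sum>i\<in>I. c i * g i x) \<partial>N)"
  shows "measure M {x \<in> space M. \<forall>i\<in>I. f i x \<in> A i} = measure N {x \<in> space N. \<forall>i\<in>I. g i x \<in> A i}"
  using assms
proof (induction I arbitrary: M N rule: finite_induct)
  case empty
  have "complex_of_real (measure M (space M)) = complex_of_real (measure N (space N))"
    using empty.prems(6) by (simp add: scaleR_conv_of_real)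
  then show ?case by (simp only: of_real_eq_iff) simp
next
  case (insert j I)
  interpret M: finite_measure M by fact
  interpret N: finite_measure N by fact
  have [measurable]: "f i \<in> borel_measurable M" "g i \<in> borel_measurable N" "A i \<in> sets borel"
    if "i \<in> insert j I" for i using insert.prems that by blast+
  have [measurable]: "f j \<in> borel_measurable M" "g j \<in> borel_measurable N" "A j \<in> sets borel" by simp_all
  have mI[measurable]: "f i \<in> borel_measurable M" "g i \<in> borel_measurable N" "A i \<in> sets borel"
    if "i \<in> I" for i using that by simp_all
  have mc[measurable]: "cis \<in> borel_measurable borel"
    by (intro borel_measurable_continuous_onI continuous_intros)
  define M' where "M' = density M (\<lambda>x. ennreal (indicator (A j) (f j x)))"
  define N' where "N' = density N (\<lambda>x. ennreal (indicator (A j) (g j x)))"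
  have ball_ins: "(\<forall>i\<in>insert j I. Q i) \<longleftrightarrow> Q j \<and> (\<forall>i\<in>I. Q i)" for Q by blast
  have em: "emeasure M' {x \<in> space M'. \<forall>i\<in>I. f i x \<in> A i} = emeasure M {x \<in> space M. \<forall>i\<in>insert j I. f i x \<in> A i}"
    unfolding M'_def ball_ins space_density
    by (intro emeasure_density_indicator sets.sets_Collect_finite_All) (use insert.hyps in measurable)
  have en: "emeasure N' {x \<in> space N'. \<forall>i\<in>I. g i x \<in> A i} = emeasure N {x \<in> space N. \<forall>i\<in>insert j I. g i x \<in> A i}"
    unfolding N'_def ball_ins space_density
    by (intro emeasure_density_indicator sets.sets_Collect_finite_All) (use insert.hyps in measurable)
  have "measure M' {x \<in> space M'. \<forall>i\<in>I. f i x \<in> A i} = measure N' {x \<in> space N'. \<forall>i\<in>I. g i x \<in> A i}"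
  proof (rule insert.IH)
    have "emeasure M' (space M') \<le> emeasure M (space M)" "emeasure N' (space N') \<le> emeasure N (space N)"
      unfolding M'_def N'_def
      by (subst emeasure_density, simp, simp, subst nn_integral_indicator[symmetric], simp,
          intro nn_integral_mono, simp add: indicator_def)+
    then show "finite_measure M'" "finite_measure N'"
      by (auto intro!: finite_measureI simp: M.emeasure_eq_measure N.emeasure_eq_measure top_unique)
    show "(\<integral>x. cis (\<Sum>i\<in>I. c i * f i x) \<partial>M') = (\<integral>x. cis (\<Sum>i\<in>I. c i * g i x) \<partial>N')" for c
    proof -
      have "(\<integral>x. indicator (A j) (f j x) *\<^sub>R cis (\<Sum>i\<in>I. c i * f i x) \<partial>M)
          = (\<integral>x. indicator (A j) (g j x) *\<^sub>R cis (\<Sum>i\<in>I. c i * g i x) \<partial>N)"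
      proof (rule restricted_char_eq[OF insert.prems(1,2)])
        fix b e
        \<comment> \<open>These coefficients make the hypothesis a statement on the joint
          characteristic function of coordinate \<open>j\<close> and a fixed combination of the
          others.\<close>
        have "(\<Sum>i\<in>insert j I. (if i = j then b else e * c i) * h i) = b * h j + e * (\<Sum>i\<in>I. c i * h i)" for h
          using insert.hyps by (simp add: sum_distrib_left mult.assoc) (auto intro!: sum.cong)
        from this[of "\<lambda>i. f i _"] this[of "\<lambda>i. g i _"] show "(\<integral>x. cis (b * f j x + e * (\<Sum>i\<in>I. c i * f i x)) \<partial>M)
           = (\<integral>x. cis (b * g j x + e * (\<Sum>i\<in>I. c i * g i x)) \<partial>N)"
          using insert.prems(6)[of "\<lambda>i. if i = j then b else e * c i"] by (simp only:)
      qed measurable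
      then show ?thesis
        unfolding M'_def N'_def by (subst (1 2) integral_density) simp_all
    qed
  qed (simp_all add: M'_def N'_def)
  then show ?case using em en by (simp add: measure_def)
qed

section \<open>Wiener measure\<close>

text \<open>A list of times and coefficient vectors encodes a finite linear functional of the path;
  repeated times are allowed, so sums of functionals are concatenations.\<close>

definition lin_ev :: "(real \<times> (real^'z)) list \<Rightarrow> (real \<Rightarrow> real^'z::finite) \<Rightarrow> real" where
  "lin_ev xs V = (\<Sum>(\<tau>, \<alpha>)\<leftarrow>xs. \<alpha> \<bullet> V \<tau>)"

text \<open>Under Wiener measure this is the covariance of the centred Gaussian variables
  \<open>lin_ev xs\<close> and \<open>lin_ev ys\<close>.\<close>

definition lin_cov :: "(real \<times> (real^'z)) list \<Rightarrow> (real \<times> (real^'z::finite)) list \<Rightarrow> real" where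
  "lin_cov xs ys = (\<Sum>(\<tau>, \<alpha>)\<leftarrow>xs. \<Sum>(\<tau>', \<beta>)\<leftarrow>ys. (\<alpha> \<bullet> \<beta>) * bm_cov \<tau> \<tau>')"

definition lin_comb :: "'b list \<Rightarrow> ('b \<Rightarrow> real) \<Rightarrow> ('b \<Rightarrow> (real \<times> (real^'z)) list) \<Rightarrow> (real \<times> (real^'z::finite)) list" where
  "lin_comb bs w x = concat (map (\<lambda>b. map (\<lambda>(\<tau>, \<alpha>). (\<tau>, w b *\<^sub>R \<alpha>)) (x b)) bs)"

lemma lin_ev_simps [simp]:
  "lin_ev [] V = 0" "lin_ev ((\<tau>, \<alpha>) # xs) V = \<alpha> \<bullet> V \<tau> + lin_ev xs V"
  "lin_ev (xs @ ys) V = lin_ev xs V + lin_ev ys V"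
  by (simp_all add: lin_ev_def)

lemma bm_cov_commute: "bm_cov s t = bm_cov t s"
  by (auto simp: bm_cov_def min_def)

lemma lin_cov_Cons: "lin_cov (x # xs) ys = lin_cov [x] ys + lin_cov xs ys"
  by (simp add: lin_cov_def)

lemma lin_cov_simps [simp]:
  "lin_cov [] ys = 0" "lin_cov (xs @ zs) ys = lin_cov xs ys + lin_cov zs ys"
  by (simp_all add: lin_cov_def)

lemma lin_cov_commute: "lin_cov xs ys = lin_cov ys xs"
proof -
  have "lin_cov xs ys = (\<Sum>i<length xs. \<Sum>j<length ys. (snd (xs ! i) \<bullet> snd (ys ! j)) * bm_cov (fst (xs ! i)) (fst (ys ! j)))"
    for xs ys :: "(real \<times> (real^'a)) list"
    by (simp add: lin_cov_def sum_list_sum_nth atLeast0LessThan case_prod_unfold)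
  then show ?thesis
    by (simp add: inner_commute bm_cov_commute) (subst sum.swap, simp add: inner_commute bm_cov_commute)
qed

lemma lin_ev_scale: "lin_ev (map (\<lambda>(\<tau>, \<alpha>). (\<tau>, c *\<^sub>R \<alpha>)) xs) V = c * lin_ev xs V"
  by (induction xs) (auto simp: algebra_simps)

lemma lin_cov_scale: "lin_cov (map (\<lambda>(\<tau>, \<alpha>). (\<tau>, c *\<^sub>R \<alpha>)) xs) ys = c * lin_cov xs ys"
  by (simp add: lin_cov_def case_prod_unfold comp_def sum_list_const_mult[symmetric] mult.assoc)

lemma lin_ev_comb: "lin_ev (lin_comb bs w x) V = (\<Sum>b\<leftarrow>bs. w b * lin_ev (x b) V)"
  by (induction bs) (auto simp: lin_comb_def lin_ev_scale)

lemma lin_cov_comb: "lin_cov (lin_comb bs w x) ys = (\<Sum>b\<leftarrow>bs. w b * lin_cov (x b) ys)"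
  by (induction bs) (auto simp: lin_comb_def lin_cov_scale)

text \<open>By assumption \<open>H\<close> lists the covariances of \<open>lin_ev y\<close> with the
  canonical process, so it is the Cameron--Martin direction dual to that variable. Linearity extends
  this to all finite functionals.\<close>

lemma lin_cov_eq_lin_ev:
  assumes "\<And>\<tau> \<alpha>. lin_cov [(\<tau>, \<alpha>)] y = \<alpha> \<bullet> H \<tau>"
  shows "lin_cov xs y = lin_ev xs H"
proof (induction xs)
  case (Cons p xs)
  then show ?case using assms[of "fst p" "snd p"] by (cases p) (subst lin_cov_Cons, simp)
qed simp

lemma wiener_char:
  assumes "two_sided_wiener P"
  shows "(\<integral>V. cis (lin_ev xs V) \<partial>P) = complex_of_real (exp (- lin_cov xs xs / 2))"
proof -
  note assms[unfolded two_sided_wiener_def, THEN conjunct2, THEN conjunct2, THEN conjunct2,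
      rule_format, of "map snd xs" "map fst xs"]
  then show ?thesis
    by (simp add: lin_ev_def lin_cov_def sum_list_sum_nth atLeast0LessThan case_prod_unfold)
qed

section \<open>The sigma-algebra on paths and uniqueness of Wiener measure\<close>

lemma space_wiener: "two_sided_wiener P \<Longrightarrow> space P = wiener_paths"
  and prob_space_wiener: "two_sided_wiener P \<Longrightarrow> prob_space P"
  by (simp_all add: two_sided_wiener_def)

lemma measurable_wiener_eval:
  assumes "two_sided_wiener P"
  shows "(\<lambda>V. V s) \<in> borel_measurable P"
proof (rule measurableI)
  fix A :: "(real^'a) set" assume "A \<in> sets borel"
  then have "{V \<in> wiener_paths. V s \<in> A} \<in> sets P"
    using assms unfolding two_sided_wiener_def by (blast intro: sigma_sets.Basic)
  moreover have "(\<lambda>V. V s) -` A \<inter> space P = {V \<in> wiener_paths. V s \<in> A}"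
    using space_wiener[OF assms] by auto
  ultimately show "(\<lambda>V. V s) -` A \<inter> space P \<in> sets P" by simp
qed simp

lemma measurable_into_wiener:
  fixes P :: "(real \<Rightarrow> real^'z::finite) measure"
  assumes P: "two_sided_wiener P"
    and f: "\<And>x. x \<in> space M \<Longrightarrow> f x \<in> wiener_paths"
    and m: "\<And>s. (\<lambda>x. f x s) \<in> borel_measurable M"
  shows "f \<in> measurable M P"
proof (rule measurable_sigma_sets)
  show "sets P = sigma_sets wiener_paths {{V \<in> wiener_paths. V t \<in> A} | t A. A \<in> sets borel}"
    using P by (simp add: two_sided_wiener_def)
  fix B assume "B \<in> {{V \<in> wiener_paths. V t \<in> A} | t A. A \<in> sets (borel :: (real^'z) measure)}"
  then obtain t A where B: "B = {V \<in> wiener_paths. V t \<in> A}" and A: "A \<in> sets borel" by blast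
  have "f -` B \<inter> space M = (\<lambda>x. f x t) -` A \<inter> space M" using f B by auto
  then show "f -` B \<inter> space M \<in> sets M" using measurable_sets[OF m A] by simp
qed (use f in auto)

text \<open>Equality of characteristic functions settles finitely many real coordinates at once, so
  the generator consists of cylinders over pairs of a time and a component; being stable under
  intersection, they determine the measure.\<close>

lemma wiener_measure_eqI:
  fixes P Q :: "(real \<Rightarrow> real^'z::finite) measure"
  assumes P: "two_sided_wiener P" and Q: "prob_space Q" "sets Q = sets P"
    and eq: "\<And>xs. (\<integral>V. cis (lin_ev xs V) \<partial>Q) = (\<integral>V. cis (lin_ev xs V) \<partial>P)"
  shows "Q = P"
proof -
  interpret P: prob_space P using P by (rule prob_space_wiener)
  interpret Q: prob_space Q by fact
  define cyl where "cyl I A = {V \<in> wiener_paths. \<forall>i\<in>I. V (fst i) $ snd i \<in> A i}"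
    for I :: "(real \<times> 'z) set" and A :: "real \<times> 'z \<Rightarrow> real set"
  define G where "G = {cyl I A | I A. finite I \<and> (\<forall>i. A i \<in> sets borel)}"
  have spP: "space P = wiener_paths" by (rule space_wiener[OF P])
  have spQ: "space Q = wiener_paths" using sets_eq_imp_space_eq[OF Q(2)] spP by simp
  have evP: "(\<lambda>V. V (fst i) $ snd i) \<in> borel_measurable P" for i :: "real \<times> 'z"
    using measurable_wiener_eval[OF P, of "fst i"] by (rule measurable_compose) simp
  have evQ: "(\<lambda>V. V (fst i) $ snd i) \<in> borel_measurable Q" for i :: "real \<times> 'z"
    using evP measurable_cong_sets[OF Q(2) refl] by blast
  have GP: "cyl I A \<in> sets P" if "finite I" "\<forall>i. A i \<in> sets borel" for I A
    using that unfolding cyl_def spP[symmetric]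
    by (intro sets.sets_Collect_finite_All) (auto intro!: measurable_sets_Collect[OF evP])
  have Gpow: "G \<subseteq> Pow wiener_paths" by (auto simp: G_def cyl_def)
  have gen: "sets P = sigma_sets wiener_paths G"
  proof
    show "sigma_sets wiener_paths G \<subseteq> sets P"
      using GP spP by (intro sets.sigma_sets_subset[of G P, unfolded spP]) (auto simp: G_def)
    \<comment> \<open>Measurability of the vector evaluations for \<open>M\<close> shows that the
      scalar cylinders generate every set of \<open>P\<close>.\<close>
    define M where "M = sigma wiener_paths G"
    have spM: "space M = wiener_paths" and seM: "sets M = sigma_sets wiener_paths G"
      unfolding M_def using Gpow by simp_all
    have comp: "(\<lambda>V. V s $ k) \<in> borel_measurable M" for s k
    proof (rule measurableI)
      fix B :: "real set" assume B: "B \<in> sets borel"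
      have "(\<lambda>V. V s $ k) -` B \<inter> space M = cyl {(s, k)} (\<lambda>_. B)" by (auto simp: cyl_def spM)
      also have "\<dots> \<in> G" using B unfolding G_def by blast
      finally show "(\<lambda>V. V s $ k) -` B \<inter> space M \<in> sets M" unfolding seM by (rule sigma_sets.Basic)
    qed simp
    have ev: "(\<lambda>V. V s) \<in> borel_measurable M" for s
      unfolding borel_measurable_euclidean_space[of "\<lambda>V. V s"]
      using comp by (auto simp: Basis_vec_def inner_axis)
    have "sigma_sets wiener_paths {{V \<in> wiener_paths. V t \<in> A} | t A. A \<in> sets (borel :: (real^'z) measure)} \<subseteq> sets M"
      using measurable_sets_Collect[OF ev] by (intro sets.sigma_sets_subset[of _ M, unfolded spM]) (auto simp: spM)
    then show "sets P \<subseteq> sigma_sets wiener_paths G"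
      using P seM unfolding two_sided_wiener_def by blast
  qed
  have inter: "Int_stable G"
  proof (rule Int_stableI)
    fix a b assume "a \<in> G" "b \<in> G"
    then obtain I A J B where ab: "a = cyl I A" "b = cyl J B" "finite I" "finite J"
      "\<forall>i. A i \<in> sets borel" "\<forall>i. B i \<in> sets borel" unfolding G_def by blast
    \<comment> \<open>A coordinate constrained on one side only receives the trivial constraint from
      the other.\<close>
    define C where "C i = (if i \<in> I then A i else UNIV) \<inter> (if i \<in> J then B i else UNIV)" for i
    have C: "\<forall>i. C i \<in> sets borel" using ab(5,6) unfolding C_def by (intro allI sets.Int) (simp_all del: split_paired_All)
    have C': "(\<forall>i\<in>I \<union> J. f i \<in> C i) \<longleftrightarrow> (\<forall>i\<in>I. f i \<in> A i) \<and> (\<forall>i\<in>J. f i \<in> B i)" for f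
    proof (intro iffI conjI ballI)
      fix i assume *: "\<forall>i\<in>I \<union> J. f i \<in> C i"
      { assume "i \<in> I"
        then have "f i \<in> C i" using * by blast
        then show "f i \<in> A i" using \<open>i \<in> I\<close> by (simp add: C_def) }
      { assume "i \<in> J"
        then have "f i \<in> C i" using * by blast
        then show "f i \<in> B i" using \<open>i \<in> J\<close> by (simp add: C_def) }
    next
      fix i assume "(\<forall>i\<in>I. f i \<in> A i) \<and> (\<forall>i\<in>J. f i \<in> B i)" "i \<in> I \<union> J"
      then have "i \<in> I \<Longrightarrow> f i \<in> A i" "i \<in> J \<Longrightarrow> f i \<in> B i" by blast+
      then show "f i \<in> C i" by (simp add: C_def)
    qed
    have "a \<inter> b = cyl (I \<union> J) C"
      unfolding ab(1,2) cyl_def C' by blast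
    then show "a \<inter> b \<in> G" unfolding G_def using C ab(3,4) by blast
  qed
  show ?thesis
  proof (rule measure_eqI_generator_eq[OF inter Gpow])
    fix X assume "X \<in> G"
    then obtain I A where X: "X = cyl I A" "finite I" "\<forall>i. A i \<in> sets borel" unfolding G_def by blast
    obtain js where js: "set js = I" "distinct js" using finite_distinct_list[OF X(2)] by blast
    have "measure Q {V \<in> space Q. \<forall>i\<in>I. V (fst i) $ snd i \<in> A i} = measure P {V \<in> space P. \<forall>i\<in>I. V (fst i) $ snd i \<in> A i}"
    proof (rule measure_cylinder_eq_if_char_eq[OF X(2)])
      fix c :: "real \<times> 'z \<Rightarrow> real"
      have "(\<Sum>i\<in>I. c i * V (fst i) $ snd i) = lin_ev (map (\<lambda>i. (fst i, c i *\<^sub>R axis (snd i) 1)) js) V" for V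
        using sum_list_distinct_conv_sum_set[OF js(2), of "\<lambda>i. c i * V (fst i) $ snd i"] js(1)
        by (simp add: lin_ev_def comp_def inner_axis' )
      then show "(\<integral>V. cis (\<Sum>i\<in>I. c i * V (fst i) $ snd i) \<partial>Q) = (\<integral>V. cis (\<Sum>i\<in>I. c i * V (fst i) $ snd i) \<partial>P)"
        by (simp only: eq)
    qed (use X evP evQ in \<open>auto intro: P.finite_measure_axioms Q.finite_measure_axioms\<close>)
    then show "emeasure Q X = emeasure P X"
      by (simp add: X(1) cyl_def spP spQ P.emeasure_eq_measure Q.emeasure_eq_measure)
  next
    have "cyl {} (\<lambda>_. UNIV) \<in> G"
      unfolding G_def by (intro CollectI exI[of _ "{}"] exI[of _ "\<lambda>_. UNIV"]) simp
    moreover have "cyl {} (\<lambda>_. UNIV) = wiener_paths" by (simp add: cyl_def)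
    ultimately have "wiener_paths \<in> G" by simp
    then show "range (\<lambda>_::nat. wiener_paths :: (real \<Rightarrow> real^'z) set) \<subseteq> G" by blast
  qed (use gen Q in auto)
qed

section \<open>The standard Gaussian vector and resampling\<close>

text \<open>Given by a Lebesgue density, because Lebesgue null sets of coefficient vectors must be
  null for it.\<close>

definition std_gaussian :: "'m::euclidean_space measure" where
  "std_gaussian = density lborel (\<lambda>a. ennreal (\<Prod>b\<in>Basis. std_normal_density (a \<bullet> b)))"

lemma sets_std_gaussian [simp, measurable_cong]: "sets std_gaussian = sets borel"
  and space_std_gaussian [simp]: "space std_gaussian = UNIV"
  by (simp_all add: std_gaussian_def)

lemma prob_space_std_gaussian: "prob_space (std_gaussian :: 'm::euclidean_space measure)"
proof (rule prob_spaceI)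
  interpret N: prob_space std_normal_distribution by (rule prob_space_normal_density) simp
  have "emeasure std_normal_distribution (space std_normal_distribution) = 1"
    by (rule N.emeasure_space_1)
  then have 1: "(\<integral>\<^sup>+x. ennreal (std_normal_density x) \<partial>lborel) = 1"
    by (simp add: emeasure_density)
  have "emeasure (std_gaussian :: 'm measure) (space std_gaussian) = (\<integral>\<^sup>+a. (\<Prod>b\<in>Basis. ennreal (std_normal_density (a \<bullet> b))) \<partial>(lborel :: 'm measure))"
    by (simp add: std_gaussian_def emeasure_density prod_ennreal)
  also have "\<dots> = 1" by (subst nn_integral_lborel_prod) (simp_all add: 1)
  finally show "emeasure (std_gaussian :: 'm measure) (space std_gaussian) = 1" .
qed

lemma null_sets_std_gaussian:
  assumes "A \<in> sets borel" "negligible A"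
  shows "emeasure std_gaussian A = 0"
proof -
  have "A \<in> null_sets lborel" using assms by (simp add: negligible_iff_null_sets null_sets_def)
  then have "A \<in> null_sets std_gaussian"
    unfolding std_gaussian_def using AE_not_in[of A lborel] assms(1)
    by (subst null_sets_density_iff) (auto elim: eventually_mono)
  then show ?thesis by auto
qed

lemma char_std_gaussian:
  fixes w :: "'m::euclidean_space \<Rightarrow> real"
  shows "(\<integral>a. cis (\<Sum>b\<in>Basis. (a \<bullet> b) * w b) \<partial>std_gaussian)
    = complex_of_real (exp (- (\<Sum>b\<in>Basis. (w b)\<^sup>2) / 2))"
proof -
  have [measurable]: "cis \<in> borel_measurable borel"
    by (intro borel_measurable_continuous_onI continuous_intros)
  interpret L: product_sigma_finite "\<lambda>_::'m. lborel :: real measure" by standard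
  have cis_prod: "cis (\<Sum>b\<in>B. h b) = (\<Prod>b\<in>B. cis (h b))" for B and h :: "'m \<Rightarrow> real"
    by (induction B rule: infinite_finite_induct) (auto simp: cis_mult[symmetric])
  define F where "F b y = std_normal_density y *\<^sub>R cis (y * w b)" for b y
  have [measurable]: "F b \<in> borel_measurable borel" for b unfolding F_def by measurable
  have Fint: "integrable lborel (F b)" for b
  proof -
    have "integrable lborel std_normal_density" by (rule integrable_normal_density) simp
    then show ?thesis
      by (rule Bochner_Integration.integrable_bound) (auto simp: F_def)
  qed
  have Fval: "integral\<^sup>L lborel (F b) = complex_of_real (exp (- (w b)\<^sup>2 / 2))" for b
  proof -
    have "integral\<^sup>L lborel (F b) = char std_normal_distribution (w b)"
      unfolding char_def F_def by (subst integral_density) (auto simp: cis_conv_exp mult.commute)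
    then show ?thesis by (simp add: char_std_normal_distribution)
  qed
  have "(\<integral>a. cis (\<Sum>b\<in>Basis. (a \<bullet> b) * w b) \<partial>(std_gaussian :: 'm measure))
      = (\<integral>a. (\<Prod>b\<in>Basis. std_normal_density (a \<bullet> b)) *\<^sub>R cis (\<Sum>b\<in>Basis. (a \<bullet> b) * w b) \<partial>(lborel :: 'm measure))"
    unfolding std_gaussian_def by (intro integral_density) (auto intro!: prod_nonneg)
  also have "\<dots> = (\<integral>a. (\<Prod>b\<in>Basis. F b (a \<bullet> b)) \<partial>(lborel :: 'm measure))"
    by (simp add: F_def cis_prod scaleR_conv_of_real prod.distrib)
  \<comment> \<open>Lebesgue measure is the image of a product over \<open>Basis\<close>, so the
    integral factorises.\<close>
  also have "\<dots> = (\<integral>f. (\<Prod>b\<in>Basis. F b ((\<Sum>b'\<in>Basis. f b' *\<^sub>R b') \<bullet> b)) \<partial>(\<Pi>\<^sub>M b\<in>(Basis::'m set). lborel))"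
    by (subst lborel_eq, subst integral_distr) measurable
  also have "\<dots> = (\<integral>f. (\<Prod>b\<in>Basis. F b (f b)) \<partial>(\<Pi>\<^sub>M b\<in>(Basis::'m set). lborel))"
    by (intro Bochner_Integration.integral_cong refl prod.cong) simp
  also have "\<dots> = (\<Prod>b\<in>(Basis::'m set). integral\<^sup>L lborel (F b))"
    by (rule L.product_integral_prod) (auto simp: Fint)
  also have "\<dots> = complex_of_real (\<Prod>b\<in>(Basis::'m set). exp (- (w b)\<^sup>2 / 2))"
    by (simp add: Fval)
  also have "(\<Prod>b\<in>(Basis::'m set). exp (- (w b)\<^sup>2 / 2)) = exp (- (\<Sum>b\<in>(Basis::'m set). (w b)\<^sup>2) / 2)"
    by (simp add: exp_sum[symmetric] sum_negf sum_divide_distrib[symmetric])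
  finally show ?thesis .
qed

text \<open>If the functionals \<open>lin_ev (x b)\<close> are orthonormal Gaussians dual to the directions \<open>H b\<close>,
  then replacing them by an independent standard Gaussian vector leaves Wiener measure invariant.\<close>

lemma wiener_resample:
  fixes P :: "(real \<Rightarrow> real^'z::finite) measure" and H :: "'m::euclidean_space \<Rightarrow> real \<Rightarrow> real^'z"
  assumes P: "two_sided_wiener P"
    and H: "\<And>b. b \<in> Basis \<Longrightarrow> H b \<in> wiener_paths"
    and cov: "\<And>b \<tau> \<alpha>. b \<in> Basis \<Longrightarrow> lin_cov [(\<tau>, \<alpha>)] (x b) = \<alpha> \<bullet> H b \<tau>"
    and orth: "\<And>b b'. b \<in> Basis \<Longrightarrow> b' \<in> Basis \<Longrightarrow> lin_ev (x b') (H b) = (if b = b' then 1 else 0)"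
  defines "T \<equiv> \<lambda>(V, a). \<lambda>r. V r + (\<Sum>b\<in>Basis. (a \<bullet> b - lin_ev (x b) V) *\<^sub>R H b r)"
  shows "T \<in> measurable (P \<Otimes>\<^sub>M std_gaussian) P" and "distr (P \<Otimes>\<^sub>M std_gaussian) P T = P"
proof -
  interpret P: prob_space P using P by (rule prob_space_wiener)
  interpret G: prob_space "std_gaussian :: 'm measure" by (rule prob_space_std_gaussian)
  interpret PG: pair_prob_space P "std_gaussian :: 'm measure" ..
  have [measurable]: "cis \<in> borel_measurable borel"
    by (intro borel_measurable_continuous_onI continuous_intros)
  note [measurable] = measurable_wiener_eval[OF P]
  have evm[measurable]: "lin_ev xs \<in> borel_measurable P" for xs
    by (induction xs) (auto simp: lin_ev_def case_prod_unfold)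
  show T[measurable]: "T \<in> measurable (P \<Otimes>\<^sub>M std_gaussian) P"
  proof (rule measurable_into_wiener[OF P])
    fix p assume "p \<in> space (P \<Otimes>\<^sub>M (std_gaussian :: 'm measure))"
    then show "T p \<in> wiener_paths"
      using H by (auto simp: T_def space_pair_measure space_wiener[OF P] wiener_paths_def
          intro!: continuous_intros)
  next
    fix s show "(\<lambda>p. T p s) \<in> borel_measurable (P \<Otimes>\<^sub>M (std_gaussian :: 'm measure))"
      unfolding T_def case_prod_unfold by measurable
  qed
  obtain bs where bs: "set bs = (Basis :: 'm set)" "distinct bs" using finite_distinct_list[OF finite_Basis] by blast
  show "distr (P \<Otimes>\<^sub>M std_gaussian) P T = P"
  proof (rule wiener_measure_eqI[OF P])
    fix xs :: "(real \<times> (real^'z)) list"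
    define w where "w b = lin_ev xs (H b)" for b
    \<comment> \<open>\<open>zs\<close> is the residual of the functional \<open>xs\<close> after
      its projections on the \<open>x b\<close> are removed: \<open>w b\<close> is the value of
      \<open>xs\<close> on \<open>H b\<close>, and by duality also its covariance with
      \<open>x b\<close>.\<close>
    define zs where "zs = xs @ lin_comb bs (\<lambda>b. - w b) x"
    have evT: "lin_ev xs (T (V, a)) = lin_ev zs V + (\<Sum>b\<in>Basis. (a \<bullet> b) * w b)" for V a
    proof -
      have "lin_ev xs (T (V, a)) = lin_ev xs V + (\<Sum>b\<in>Basis. (a \<bullet> b - lin_ev (x b) V) * lin_ev xs (H b))"
        unfolding T_def
        by (induction xs) (auto simp: inner_sum_right inner_add_right distrib_left sum.distrib)
      moreover have "lin_ev zs V = lin_ev xs V - (\<Sum>b\<in>Basis. w b * lin_ev (x b) V)"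
        by (simp add: zs_def lin_ev_comb sum_list_distinct_conv_sum_set[OF bs(2)] bs(1) sum_negf)
      ultimately show ?thesis
        by (simp add: w_def algebra_simps sum_subtractf)
    qed
    have covzs: "lin_cov zs ys = lin_cov xs ys - (\<Sum>b\<in>Basis. w b * lin_cov (x b) ys)" for ys
      by (simp add: zs_def lin_cov_comb sum_list_distinct_conv_sum_set[OF bs(2)] bs(1) sum_negf)
    have covx: "lin_cov ys (x b) = lin_ev ys (H b)" if "b \<in> Basis" for b ys
      using cov[OF that] by (rule lin_cov_eq_lin_ev)
    have covx': "lin_cov (x b) ys = lin_ev ys (H b)" if "b \<in> Basis" for b ys
      using covx[OF that] lin_cov_commute by metis
    have "lin_cov zs (x b) = 0" if b: "b \<in> Basis" for b
    proof -
      have "(\<Sum>b'\<in>Basis. w b' * lin_cov (x b') (x b)) = (\<Sum>b'\<in>Basis. if b' = b then w b else 0)"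
        using b orth by (intro sum.cong) (auto simp: covx)
      then show ?thesis using b by (simp add: covzs covx w_def)
    qed
    then have "lin_cov zs zs = lin_cov xs zs"
      by (subst covzs) (simp add: lin_cov_commute[of _ zs])
    also have "\<dots> = lin_cov xs xs - (\<Sum>b\<in>Basis. (w b)\<^sup>2)"
      by (subst lin_cov_commute, subst covzs)
         (simp add: covx' w_def power2_eq_square)
    \<comment> \<open>Pythagoras: the residual loses exactly the variance that the independent
      Gaussian vector puts back below.\<close>
    finally have var: "lin_cov zs zs = lin_cov xs xs - (\<Sum>b\<in>Basis. (w b)\<^sup>2)" .
    have "(\<integral>V. cis (lin_ev xs V) \<partial>distr (P \<Otimes>\<^sub>M std_gaussian) P T)
        = (\<integral>p. cis (lin_ev xs (T p)) \<partial>(P \<Otimes>\<^sub>M std_gaussian))"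
      by (rule integral_distr) measurable
    also have "\<dots> = (\<integral>V. (\<integral>a. cis (lin_ev xs (T (V, a))) \<partial>std_gaussian) \<partial>P)"
      by (rule PG.integral_fst'[symmetric], rule PG.integrable_const_bound[where B = 1]) auto
    also have "\<dots> = (\<integral>V. cis (lin_ev zs V) * (\<integral>a. cis (\<Sum>b\<in>Basis. (a \<bullet> b) * w b) \<partial>(std_gaussian :: 'm measure)) \<partial>P)"
      by (simp add: evT cis_mult[symmetric])
    also have "\<dots> = complex_of_real (exp (- lin_cov zs zs / 2)) * complex_of_real (exp (- (\<Sum>b\<in>Basis. (w b)\<^sup>2) / 2))"
      by (simp add: char_std_gaussian wiener_char[OF P])
    also have "\<dots> = complex_of_real (exp (- lin_cov xs xs / 2))"
      unfolding of_real_mult[symmetric] exp_add[symmetric] var by (simp add: field_simps)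
    finally show "(\<integral>V. cis (lin_ev xs V) \<partial>distr (P \<Otimes>\<^sub>M std_gaussian) P T) = (\<integral>V. cis (lin_ev xs V) \<partial>P)"
      by (simp add: wiener_char[OF P])
  next
    show "prob_space (distr (P \<Otimes>\<^sub>M std_gaussian) P T)" by (rule PG.prob_space_distr[OF T])
  qed simp
qed

section \<open>Cocycles along Cameron--Martin directions\<close>

text \<open>Finitely many values of the path determine its Bernstein approximation on
  \<open>[0, t]\<close>, and \<open>F\<close> of that is a continuous function of these values. The
  approximations converge uniformly, so \<open>F\<close> is a pointwise limit of measurable
  functions.\<close>

lemma borel_measurable_adapted_continuous:
  fixes F :: "(real \<Rightarrow> real^'z::finite) \<Rightarrow> 'm::euclidean_space"
  assumes P: "two_sided_wiener P" and t: "t > 0"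
    and adapted: "\<And>V V'. V \<in> wiener_paths \<Longrightarrow> V' \<in> wiener_paths \<Longrightarrow> (\<forall>r\<in>{0..t}. V r = V' r) \<Longrightarrow> F V = F V'"
    and cont: "\<And>Vs V. (\<And>n. Vs n \<in> wiener_paths) \<Longrightarrow> V \<in> wiener_paths \<Longrightarrow> loc_unif_conv Vs V \<Longrightarrow> (\<lambda>n. F (Vs n)) \<longlonglongrightarrow> F V"
  shows "F \<in> borel_measurable P"
proof -
  \<comment> \<open>Rescaled time, clamped so that the approximating paths live on the whole line
    and are constant off \<open>[0, t]\<close>; adaptedness hides this from
    \<open>F\<close>.\<close>
  define c where "c r = max 0 (min 1 (r / t))" for r
  have c01: "c r \<in> {0..1}" for r by (simp add: c_def)
  have c0: "c 0 = 0" by (simp add: c_def)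
  have c_cont: "continuous_on UNIV c" unfolding c_def using t by (intro continuous_intros) auto
  \<comment> \<open>Subtracting the value at 0 puts the approximation into
    \<open>wiener_paths\<close> for every \<open>x\<close>.\<close>
  define bern :: "nat \<Rightarrow> (nat \<Rightarrow> real^'z) \<Rightarrow> real \<Rightarrow> real^'z"
    where "bern n x r = (\<Sum>k\<le>n. (Bernstein n k (c r) - Bernstein n k 0) *\<^sub>R x k)" for n x r
  have Bcont: "continuous_on UNIV (\<lambda>r. Bernstein n k (c r))" for n k
    unfolding Bernstein_def by (intro continuous_intros c_cont)
  have bern_wp: "bern n x \<in> wiener_paths" for n x
    unfolding wiener_paths_def bern_def
    by (auto intro!: continuous_intros Bcont simp: c0)
  have bern_cont: "continuous_on UNIV (\<lambda>x. F (bern n x))" for n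
  proof (unfold continuous_on_sequentially, intro ballI allI impI, elim conjE)
    fix X and x :: "nat \<Rightarrow> real^'z" assume X: "X \<longlonglongrightarrow> x"
    have Xk: "(\<lambda>i. X i k) \<longlonglongrightarrow> x k" for k
      using continuous_on_tendsto_compose[OF continuous_on_product_coordinates X] by simp
    have "loc_unif_conv (\<lambda>i. bern n (X i)) (bern n x)"
      unfolding loc_unif_conv_def
    proof (intro allI impI)
      fix T e :: real assume e: "e > 0"
      have bnd: "norm (bern n (X i) s - bern n x s) \<le> (\<Sum>k\<le>n. norm (X i k - x k))" for i s
      proof -
        have B1: "\<bar>Bernstein n k (c s) - Bernstein n k 0\<bar> \<le> 1" if "k \<le> n" for k
        proof -
          have le1: "Bernstein n k y \<le> 1" if "y \<in> {0..1}" for y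
            using member_le_sum[of k "{..n}" "\<lambda>k. Bernstein n k y"] \<open>k \<le> n\<close> that
            by (simp add: Bernstein_nonneg)
          have ge0: "Bernstein n k y \<ge> 0" if "y \<in> {0..1}" for y
            using that by (simp add: Bernstein_nonneg)
          show ?thesis using le1[of "c s"] le1[of 0] ge0[of "c s"] ge0[of 0] c01[of s] by auto
        qed
        have "bern n (X i) s - bern n x s = (\<Sum>k\<le>n. (Bernstein n k (c s) - Bernstein n k 0) *\<^sub>R (X i k - x k))"
          by (simp add: bern_def sum_subtractf scaleR_diff_right)
        also have "norm \<dots> \<le> (\<Sum>k\<le>n. norm (X i k - x k))"
          using B1 by (intro sum_norm_le) (auto intro!: mult_left_le_one_le)
        finally show ?thesis .
      qed
      have "(\<lambda>i. \<Sum>k\<le>n. norm (X i k - x k)) \<longlonglongrightarrow> (\<Sum>k\<le>n. norm (x k - x k))"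
        by (intro tendsto_intros Xk)
      then have "eventually (\<lambda>i. (\<Sum>k\<le>n. norm (X i k - x k)) < e) sequentially"
        using e by (intro order_tendstoD(2)) simp_all
      then show "eventually (\<lambda>i. \<forall>s\<in>{- T..T}. norm (bern n (X i) s - bern n x s) < e) sequentially"
        by eventually_elim (use bnd le_less_trans in blast)
    qed
    then have "(\<lambda>i. F (bern n (X i))) \<longlonglongrightarrow> F (bern n x)" by (intro cont bern_wp)
    then show "((\<lambda>x. F (bern n x)) \<circ> X) \<longlonglongrightarrow> F (bern n x)" by (simp add: comp_def)
  qed
  have meas: "(\<lambda>V. F (bern n (\<lambda>k. V (t * (real k / real n))))) \<in> borel_measurable P" for n
  proof (rule measurable_compose[where N = borel and g = "\<lambda>x. F (bern n x)"])
    show "(\<lambda>V k. V (t * (real k / real n))) \<in> borel_measurable P"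
      by (intro measurable_coordinatewise_then_product measurable_wiener_eval P)
    show "(\<lambda>x. F (bern n x)) \<in> borel_measurable borel"
      by (intro borel_measurable_continuous_onI bern_cont)
  qed
  show ?thesis
  proof (rule borel_measurable_LIMSEQ_metric[OF meas])
    fix V assume "V \<in> space P"
    then have V: "V \<in> wiener_paths" "continuous_on UNIV V" "V 0 = 0"
      using space_wiener[OF P] by (auto simp: wiener_paths_def)
    define V' where "V' r = V (t * c r)" for r
    have V'wp: "V' \<in> wiener_paths"
      unfolding wiener_paths_def V'_def using V
      by (auto intro!: continuous_on_compose2[OF V(2)] continuous_intros c_cont simp: c0)
    have "F V = F V'"
      using V V'wp t by (intro adapted) (auto simp: V'_def c_def)
    moreover have "loc_unif_conv (\<lambda>n. bern n (\<lambda>k. V (t * (real k / real n)))) V'"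
      unfolding loc_unif_conv_def
    proof (intro allI impI)
      fix T e :: real assume e: "e > 0"
      \<comment> \<open>The Bernstein error enters twice, at \<open>c s\<close> and at 0, and is
        summed over the coordinates.\<close>
      define e' where "e' = e / (2 * real CARD('z))"
      have e'0: "e' > 0" using e by (simp add: e'_def)
      have "\<exists>N. \<forall>n y. N \<le> n \<and> y \<in> {0..1} \<longrightarrow>
          \<bar>V (t * y) $ i - (\<Sum>k\<le>n. V (t * (real k / real n)) $ i * Bernstein n k y)\<bar> < e'" for i
        by (rule Bernstein_Weierstrass[OF _ e'0])
           (auto intro!: continuous_intros continuous_on_compose2[OF V(2)])
      then have "\<forall>i. \<exists>N. \<forall>n y. N \<le> n \<and> y \<in> {0..1} \<longrightarrow>
          \<bar>V (t * y) $ i - (\<Sum>k\<le>n. V (t * (real k / real n)) $ i * Bernstein n k y)\<bar> < e'" by (intro allI)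
      from choice[OF this] obtain N where N: "\<And>i n y. N i \<le> n \<Longrightarrow> y \<in> {0..1} \<Longrightarrow>
          \<bar>V (t * y) $ i - (\<Sum>k\<le>n. V (t * (real k / real n)) $ i * Bernstein n k y)\<bar> < e'" by blast
      have "norm (bern n (\<lambda>k. V (t * (real k / real n))) s - V' s) < e" if n: "n \<ge> Max (range N)" for n s
      proof -
        let ?d = "bern n (\<lambda>k. V (t * (real k / real n))) s - V' s"
        have comp: "\<bar>?d $ i\<bar> < 2 * e'" for i
        proof -
          have Ni: "N i \<le> n" using n Max_ge[of "range N" "N i"] by simp
          have "?d $ i = (\<Sum>k\<le>n. V (t * (real k / real n)) $ i * Bernstein n k (c s))
              - (\<Sum>k\<le>n. V (t * (real k / real n)) $ i * Bernstein n k 0) - V (t * c s) $ i"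
            by (simp add: bern_def V'_def sum_component algebra_simps sum_subtractf)
          then show ?thesis using N[OF Ni c01[of s]] N[OF Ni, of 0] V(3) by simp
        qed
        have "norm ?d \<le> (\<Sum>i\<in>UNIV. \<bar>?d $ i\<bar>)" by (rule norm_le_l1_cart)
        also have "\<dots> < (\<Sum>i\<in>(UNIV::'z set). 2 * e')" by (intro sum_strict_mono comp) auto
        also have "\<dots> = e" by (simp add: e'_def)
        finally show ?thesis .
      qed
      then show "eventually (\<lambda>n. \<forall>s\<in>{- T..T}. norm (bern n (\<lambda>k. V (t * (real k / real n))) s - V' s) < e) sequentially"
        unfolding eventually_sequentially by blast
    qed
    ultimately show "(\<lambda>n. F (bern n (\<lambda>k. V (t * (real k / real n))))) \<longlonglongrightarrow> F V"
      using cont bern_wp V'wp by simp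
  qed
qed

section \<open>Continuity of the Jacobian in time\<close>

lemma shift_wiener_paths: "V \<in> wiener_paths \<Longrightarrow> shift s V \<in> wiener_paths"
  unfolding wiener_paths_def shift_def
  by (auto intro!: continuous_intros continuous_on_compose2[of UNIV V])

lemma loc_unif_conv_shift:
  assumes V: "V \<in> wiener_paths" and S: "S \<longlonglongrightarrow> s"
  shows "loc_unif_conv (\<lambda>n. shift (S n) V) (shift s V)"
  unfolding loc_unif_conv_def
proof (intro allI impI)
  fix T e :: real assume e: "e > 0"
  \<comment> \<open>Room for \<open>r + S n\<close> once \<open>S n\<close> is within distance 1 of
    \<open>s\<close>.\<close>
  define R where "R = \<bar>T\<bar> + \<bar>s\<bar> + 1"
  have "uniformly_continuous_on {-R..R} V"
    using V by (intro compact_uniformly_continuous) (auto simp: wiener_paths_def intro: continuous_on_subset)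
  then obtain d where d: "d > 0" "\<And>x y. x \<in> {-R..R} \<Longrightarrow> y \<in> {-R..R} \<Longrightarrow> dist y x < d \<Longrightarrow> dist (V y) (V x) < e / 2"
    unfolding uniformly_continuous_on_def using half_gt_zero[OF e] by metis
  have "eventually (\<lambda>n. dist (S n) s < min d 1) sequentially"
    using S d(1) by (intro tendstoD) simp_all
  then show "eventually (\<lambda>n. \<forall>r\<in>{- T..T}. norm (shift (S n) V r - shift s V r) < e) sequentially"
  proof (eventually_elim, intro ballI)
    fix n r assume n: "dist (S n) s < min d 1" and r: "r \<in> {- T..T}"
    have "dist (V (r + S n)) (V (r + s)) < e / 2" "dist (V (S n)) (V s) < e / 2"
      using n r by (intro d(2); auto simp: R_def dist_real_def)+
    moreover have "shift (S n) V r - shift s V r = (V (r + S n) - V (r + s)) - (V (S n) - V s)"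
      by (simp add: shift_def)
    ultimately show "norm (shift (S n) V r - shift s V r) < e"
      using norm_triangle_ineq4[of "V (r + S n) - V (r + s)" "V (S n) - V s"] by (simp add: dist_norm)
  qed
qed

lemma loc_unif_conv_const: "loc_unif_conv (\<lambda>_. V) V"
  by (simp add: loc_unif_conv_def)

text \<open>Varying \<open>s\<close> moves the remaining time, the base point and the shifted path
  simultaneously, hence the appeal to joint sequential continuity.\<close>

lemma continuous_on_jac:
  assumes \<phi>: "adapted_cocycle \<phi>" and A: "assumption_A \<phi> Du \<sigma>" and V: "V \<in> wiener_paths"
  shows "continuous_on {0..t} (\<lambda>s. jac \<phi> Du s t u V \<xi>)"
proof (unfold continuous_on_sequentially, intro ballI allI impI, elim conjE)
  fix S s assume s: "s \<in> {0..t}" and S: "\<forall>n. S n \<in> {0..t}" "S \<longlonglongrightarrow> s"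
  have "(\<lambda>n. \<phi> (S n) u V) \<longlonglongrightarrow> \<phi> s u V"
    using \<phi>[unfolded adapted_cocycle_def, THEN conjunct2, THEN conjunct2, THEN conjunct2, rule_format,
        of S "\<lambda>_. V" s V "\<lambda>_. u" u] S s V loc_unif_conv_const[of V] by simp
  moreover have "(\<lambda>n. t - S n) \<longlonglongrightarrow> t - s" by (intro tendsto_intros S)
  ultimately have "(\<lambda>n. Du (t - S n) (\<phi> (S n) u V) (shift (S n) V) \<xi>) \<longlonglongrightarrow> Du (t - s) (\<phi> s u V) (shift s V) \<xi>"
    using A[unfolded assumption_A_def, THEN conjunct2, THEN conjunct2, THEN conjunct1, rule_format,
        of "\<lambda>n. t - S n" "\<lambda>n. shift (S n) V" "t - s" "shift s V" "\<lambda>n. \<phi> (S n) u V" "\<phi> s u V" "\<lambda>_. \<xi>" \<xi>]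
      S s shift_wiener_paths[OF V] loc_unif_conv_shift[OF V S(2)] by simp
  then show "((\<lambda>s. jac \<phi> Du s t u V \<xi>) \<circ> S) \<longlonglongrightarrow> jac \<phi> Du s t u V \<xi>"
    by (simp add: jac_def comp_def)
qed

lemma borel_measurable_cocycle:
  fixes L :: "'x::real_inner \<Rightarrow> 'm::euclidean_space" and \<phi> :: "real \<Rightarrow> 'x \<Rightarrow> (real \<Rightarrow> real^'z::finite) \<Rightarrow> 'x"
  assumes P: "two_sided_wiener P" and t: "t > 0" and \<phi>: "adapted_cocycle \<phi>" and L: "bounded_linear L"
  shows "(\<lambda>V. L (\<phi> t u V)) \<in> borel_measurable P"
proof (rule borel_measurable_adapted_continuous[OF P t])
  fix V V' :: "real \<Rightarrow> real^'z" assume "V \<in> wiener_paths" "V' \<in> wiener_paths" "\<forall>r\<in>{0..t}. V r = V' r"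
  then show "L (\<phi> t u V) = L (\<phi> t u V')"
    using \<phi>[unfolded adapted_cocycle_def, THEN conjunct2, THEN conjunct2, THEN conjunct1, rule_format, of t V V' u] t by simp
next
  fix Vs and V :: "real \<Rightarrow> real^'z"
  assume "\<And>n. Vs n \<in> wiener_paths" "V \<in> wiener_paths" "loc_unif_conv Vs V"
  then have "(\<lambda>n. \<phi> t u (Vs n)) \<longlonglongrightarrow> \<phi> t u V"
    using \<phi>[unfolded adapted_cocycle_def, THEN conjunct2, THEN conjunct2, THEN conjunct2, rule_format,
        of "\<lambda>_. t" Vs t V "\<lambda>_. u" u] t by simp
  then show "(\<lambda>n. L (\<phi> t u (Vs n))) \<longlonglongrightarrow> L (\<phi> t u V)"
    by (rule bounded_linear.tendsto[OF L])
qed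

section \<open>Cells and their Cameron--Martin paths\<close>

text \<open>The factor gives the associated path unit Cameron--Martin norm when the cell lies in
  \<open>[0, t]\<close>.\<close>

definition cell :: "real \<Rightarrow> real \<Rightarrow> 'z \<Rightarrow> real \<Rightarrow> real^'z::finite" where
  "cell \<delta> p k s = (indicator {p..p + \<delta>} s / sqrt \<delta>) *\<^sub>R axis k 1"

text \<open>For nonnegative \<open>p\<close> the difference of covariances is the length of the part
  of the cell before \<open>r\<close>, so this is the primitive of \<open>cell\<close>. Writing it
  with \<open>bm_cov\<close> makes duality to the increment a matter of unfolding.\<close>

definition cell_path :: "real \<Rightarrow> real \<Rightarrow> 'z \<Rightarrow> real \<Rightarrow> real^'z::finite" where
  "cell_path \<delta> p k r = ((bm_cov r (p + \<delta>) - bm_cov r p) / sqrt \<delta>) *\<^sub>R axis k 1"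

text \<open>Encodes component \<open>k\<close> of \<open>V (p + \<delta>) - V p\<close>, divided by
  \<open>sqrt \<delta>\<close>.\<close>

definition cell_increment :: "real \<Rightarrow> real \<Rightarrow> 'z \<Rightarrow> (real \<times> (real^'z::finite)) list" where
  "cell_increment \<delta> p k = [(p + \<delta>, axis k (1 / sqrt \<delta>)), (p, axis k (- (1 / sqrt \<delta>)))]"

lemma bm_cov_nonneg_right: "q \<ge> 0 \<Longrightarrow> bm_cov r q = max 0 (min r q)"
  by (auto simp: bm_cov_def)

lemma lin_cov_cell_increment: "lin_cov [(\<tau>, \<alpha>)] (cell_increment \<delta> p k) = \<alpha> \<bullet> cell_path \<delta> p k \<tau>"
  by (simp add: lin_cov_def cell_increment_def cell_path_def inner_axis algebra_simps diff_divide_distrib)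

lemma cell_path_wiener_paths:
  assumes "p \<ge> 0" "\<delta> > 0"
  shows "cell_path \<delta> p k \<in> wiener_paths"
  using assms unfolding wiener_paths_def cell_path_def
  by (auto simp: bm_cov_nonneg_right intro!: continuous_intros)

text \<open>The mixed second difference \<open>B\<close> of \<open>bm_cov\<close> is the length of
  the overlap of the two cells: \<delta> for equal indices, 0 otherwise, since distinct cells meet
  at most in an end point.\<close>

lemma lin_ev_cell_increment:
  assumes \<delta>: "\<delta> > 0"
  shows "lin_ev (cell_increment \<delta> (real j' * \<delta>) k') (cell_path \<delta> (real j * \<delta>) k) = (if (j, k) = (j', k') then 1 else 0)"
proof -
  define B where "B = bm_cov (real j' * \<delta> + \<delta>) (real j * \<delta> + \<delta>) - bm_cov (real j' * \<delta> + \<delta>) (real j * \<delta>)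
    - bm_cov (real j' * \<delta>) (real j * \<delta> + \<delta>) + bm_cov (real j' * \<delta>) (real j * \<delta>)"
  have nn: "real i * \<delta> \<ge> 0" for i using \<delta> by simp
  have step: "real i * \<delta> + \<delta> \<le> real i' * \<delta>" if "i < i'" for i i'
  proof -
    have "real (Suc i) * \<delta> \<le> real i' * \<delta>" using that \<delta> by (intro mult_right_mono) auto
    then show ?thesis by (simp add: algebra_simps)
  qed
  have B: "B = (if j = j' then \<delta> else 0)"
    using nn[of j] nn[of j'] step[of j j'] step[of j' j] \<delta>
    by (cases j j' rule: linorder_cases) (auto simp: B_def bm_cov_nonneg_right)
  have "lin_ev (cell_increment \<delta> (real j' * \<delta>) k') (cell_path \<delta> (real j * \<delta>) k)
      = (if k = k' then B / (sqrt \<delta> * sqrt \<delta>) else 0)"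
    unfolding cell_increment_def cell_path_def B_def using \<delta>
    by (simp add: inner_axis_axis field_simps)
  then show ?thesis using B \<delta> by simp
qed

lemma has_bochner_integral_cell:
  assumes "R \<ge> 0" "p \<ge> 0" "\<delta> > 0"
  shows "has_bochner_integral (lebesgue_on {0..R}) (cell \<delta> p k) (cell_path \<delta> p k R)"
proof -
  have "has_bochner_integral (lebesgue_on {0..R}) (indicator ({p..p + \<delta>} \<inter> {0..R}) :: real \<Rightarrow> real)
      (measure (lebesgue_on {0..R}) ({p..p + \<delta>} \<inter> {0..R}))"
    by (intro has_bochner_integral_real_indicator)
       (auto simp: emeasure_restrict_space emeasure_lborel_Icc_eq intro!: sets_restrict_space_iff[THEN iffD2])
  moreover have "{p..p + \<delta>} \<inter> {0..R} = {p..min R (p + \<delta>)}" using assms by auto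
  then have "measure (lebesgue_on {0..R}) ({p..p + \<delta>} \<inter> {0..R}) = bm_cov R (p + \<delta>) - bm_cov R p"
    using assms by (subst measure_restrict_space) (auto simp: bm_cov_nonneg_right)
  ultimately have "has_bochner_integral (lebesgue_on {0..R}) (indicator {p..p + \<delta>} :: real \<Rightarrow> real) (bm_cov R (p + \<delta>) - bm_cov R p)"
    by (subst has_bochner_integral_cong[where g = "indicator ({p..p + \<delta>} \<inter> {0..R})"]) (auto simp: indicator_def)
  then have "has_bochner_integral (lebesgue_on {0..R}) (\<lambda>s. (indicator {p..p + \<delta>} s / sqrt \<delta>) *\<^sub>R (axis k 1 :: real^'a))
      (((bm_cov R (p + \<delta>) - bm_cov R p) / sqrt \<delta>) *\<^sub>R axis k 1)"
    by (intro has_bochner_integral_scaleR_left has_bochner_integral_divide_zero)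
  then show ?thesis by (simp add: cell_def[abs_def] cell_path_def)
qed

text \<open>The cells lie in \<open>[0, t]\<close>, so their paths are constant after
  \<open>t\<close>, as the cut-off in \<open>cm_path\<close> prescribes.\<close>

lemma cm_path_cells:
  fixes k :: "'b \<Rightarrow> 'z::finite"
  assumes "\<And>b. b \<in> B \<Longrightarrow> 0 \<le> p b" "\<And>b. b \<in> B \<Longrightarrow> p b + \<delta> \<le> t" "\<delta> > 0" "t \<ge> 0"
  shows "cm_path t (\<lambda>s. \<Sum>b\<in>B. c b *\<^sub>R cell \<delta> (p b) (k b) s) = (\<lambda>r. \<Sum>b\<in>B. c b *\<^sub>R cell_path \<delta> (p b) (k b) r)"
proof
  fix r
  show "cm_path t (\<lambda>s. \<Sum>b\<in>B. c b *\<^sub>R cell \<delta> (p b) (k b) s) r = (\<Sum>b\<in>B. c b *\<^sub>R cell_path \<delta> (p b) (k b) r)"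
  proof (cases "r \<le> 0")
    case True
    have "cell_path \<delta> (p b) (k b) r = 0" if "b \<in> B" for b
      using assms(1)[OF that] assms(3) True by (simp add: cell_path_def bm_cov_nonneg_right)
    then show ?thesis using True by (simp add: cm_path_def)
  next
    case False
    have "has_bochner_integral (lebesgue_on {0..min r t}) (\<lambda>s. \<Sum>b\<in>B. c b *\<^sub>R cell \<delta> (p b) (k b) s)
        (\<Sum>b\<in>B. c b *\<^sub>R cell_path \<delta> (p b) (k b) (min r t))"
      using False assms
      by (intro has_bochner_integral_sum has_bochner_integral_scaleR_right has_bochner_integral_cell) auto
    moreover have "cell_path \<delta> (p b) (k b) (min r t) = cell_path \<delta> (p b) (k b) r" if "b \<in> B" for b
      using assms(1,2)[OF that] assms(3) False by (simp add: cell_path_def bm_cov_nonneg_right min_def)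
    ultimately show ?thesis using False by (simp add: cm_path_def has_bochner_integral_integral_eq)
  qed
qed

text \<open>A crude bound is enough, as long as it is linear in \<open>norm a\<close>: it turns a
  remainder estimate in the Cameron--Martin norm into one in the parameter. Each of the
  \<open>DIM('m)\<close> summands is at most \<open>norm a / sqrt \<delta>\<close>, and
  \<open>sqrt t\<close> comes from the interval.\<close>

lemma cm_norm_cells:
  fixes p :: "'m::euclidean_space \<Rightarrow> real" and k :: "'m \<Rightarrow> 'z::finite"
  assumes "\<delta> > 0" "t \<ge> 0"
  defines "h \<equiv> \<lambda>a s. \<Sum>b\<in>Basis. (a \<bullet> b) *\<^sub>R cell \<delta> (p b) (k b) s"
  shows "h a \<in> cm_space t" and "cm_norm t (h a) \<le> (DIM('m) / sqrt \<delta> * sqrt t) * norm a"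
proof -
  define C where "C = DIM('m) / sqrt \<delta> * norm a"
  have C0: "C \<ge> 0" using assms by (simp add: C_def)
  have hb: "norm (h a s) \<le> C" for s
  proof -
    have "norm (h a s) \<le> (\<Sum>b\<in>(Basis::'m set). norm a * (1 / sqrt \<delta>))"
      unfolding h_def
    proof (rule sum_norm_le)
      fix b :: 'm assume b: "b \<in> Basis"
      have "norm (cell \<delta> (p b) (k b) s) \<le> 1 / sqrt \<delta>"
        using assms(1) by (simp add: cell_def indicator_def)
      then show "norm ((a \<bullet> b) *\<^sub>R cell \<delta> (p b) (k b) s) \<le> norm a * (1 / sqrt \<delta>)"
        using Basis_le_norm[OF b, of a] assms(1) unfolding norm_scaleR by (intro mult_mono) auto
    qed
    then show ?thesis by (simp add: C_def field_simps)
  qed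
  have "h a \<in> borel_measurable lborel"
    unfolding h_def cell_def by measurable
  then have hm: "h a \<in> borel_measurable lebesgue" by (rule measurable_completion)
  interpret finite_measure "lebesgue_on {0..t}"
    by (rule finite_measureI) (simp add: emeasure_restrict_space emeasure_lborel_Icc_eq)
  have int: "integrable (lebesgue_on {0..t}) (\<lambda>s. (norm (h a s))\<^sup>2)"
  proof (rule integrable_const_bound[where B = "C\<^sup>2"])
    show "AE s in lebesgue_on {0..t}. norm ((norm (h a s))\<^sup>2) \<le> C\<^sup>2"
      using hb by (intro AE_I2) (simp add: power_mono)
    show "(\<lambda>s. (norm (h a s))\<^sup>2) \<in> borel_measurable (lebesgue_on {0..t})"
      by (intro borel_measurable_power measurable_restrict_space1 measurable_compose[OF hm borel_measurable_norm])
  qed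
  then show "h a \<in> cm_space t" using hm by (simp add: cm_space_def)
  have "integral\<^sup>L (lebesgue_on {0..t}) (\<lambda>s. (norm (h a s))\<^sup>2) \<le> integral\<^sup>L (lebesgue_on {0..t}) (\<lambda>s. C\<^sup>2)"
    using hb by (intro integral_mono int) (auto intro!: power_mono)
  also have "\<dots> = C\<^sup>2 * t" using assms(2) by (simp add: measure_restrict_space mult.commute)
  finally have "cm_norm t (h a) \<le> sqrt (C\<^sup>2 * t)" unfolding cm_norm_def by (rule real_sqrt_le_mono)
  also have "\<dots> = C * sqrt t" using C0 by (simp add: real_sqrt_mult)
  finally show "cm_norm t (h a) \<le> (DIM('m) / sqrt \<delta> * sqrt t) * norm a" by (simp add: C_def mult_ac)
qed

section \<open>Derivatives in cell directions\<close>

text \<open>For cells inside \<open>[0, t]\<close> this is the Malliavin derivative in the direction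
  \<open>cell \<delta> p k\<close>.\<close>

definition cell_deriv ::
  "(real \<Rightarrow> 'x::{real_inner,complete_space} \<Rightarrow> (real \<Rightarrow> real^'z::finite) \<Rightarrow> 'x) \<Rightarrow>
   (real \<Rightarrow> 'x \<Rightarrow> (real \<Rightarrow> real^'z) \<Rightarrow> 'x \<Rightarrow> 'x) \<Rightarrow> ('z \<Rightarrow> 'x) \<Rightarrow>
   real \<Rightarrow> 'x \<Rightarrow> (real \<Rightarrow> real^'z) \<Rightarrow> real \<Rightarrow> real \<Rightarrow> 'z \<Rightarrow> 'x" where
  "cell_deriv \<phi> Du \<sigma> t u V \<delta> p k = (1 / sqrt \<delta>) *\<^sub>R integral {p..p + \<delta>} (\<lambda>s. jac \<phi> Du s t u V (\<sigma> k))"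

lemma malliavin_deriv_cells:
  fixes k :: "'b \<Rightarrow> 'z::finite" and \<phi> :: "real \<Rightarrow> 'x::{real_inner,complete_space} \<Rightarrow> (real \<Rightarrow> real^'z) \<Rightarrow> 'x"
  assumes \<phi>: "adapted_cocycle \<phi>" and A: "assumption_A \<phi> Du \<sigma>" and V: "V \<in> wiener_paths"
    and p: "\<And>b. b \<in> B \<Longrightarrow> 0 \<le> p b" "\<And>b. b \<in> B \<Longrightarrow> p b + \<delta> \<le> t" and \<delta>: "\<delta> > 0" and B: "finite B"
  shows "malliavin_deriv \<phi> Du \<sigma> t u V (\<lambda>s. \<Sum>b\<in>B. c b *\<^sub>R cell \<delta> (p b) (k b) s)
    = (\<Sum>b\<in>B. c b *\<^sub>R cell_deriv \<phi> Du \<sigma> t u V \<delta> (p b) (k b))"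
proof -
  define J where "J i s = jac \<phi> Du s t u V (\<sigma> i)" for i s
  \<comment> \<open>A cell excites a single noise coordinate, so only \<open>i = k b\<close>
    contributes.\<close>
  define D where "D b i = (if k b = i then cell_deriv \<phi> Du \<sigma> t u V \<delta> (p b) i else 0)" for b i
  have one: "((\<lambda>s. cell \<delta> (p b) (k b) s $ i *\<^sub>R J i s) has_integral D b i) {0..t}" if b: "b \<in> B" for b i
  proof (cases "k b = i")
    case True
    have sub: "{p b..p b + \<delta>} \<subseteq> {0..t}" using p[OF b] by auto
    have "J i integrable_on {p b..p b + \<delta>}"
      unfolding J_def using continuous_on_subset[OF continuous_on_jac[OF \<phi> A V] sub]
      by (intro integrable_continuous_inner)
    then have "(J i has_integral integral {p b..p b + \<delta>} (J i)) {p b..p b + \<delta>}" by (rule integrable_integral)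
    then have "((\<lambda>s. if s \<in> {p b..p b + \<delta>} then J i s else 0) has_integral integral {p b..p b + \<delta>} (J i)) {0..t}"
      using p[OF b] \<delta> by (intro has_integral_restrict_interval) auto
    then have "((\<lambda>s. (1 / sqrt \<delta>) *\<^sub>R (if s \<in> {p b..p b + \<delta>} then J i s else 0)) has_integral
        (1 / sqrt \<delta>) *\<^sub>R integral {p b..p b + \<delta>} (J i)) {0..t}"
      by (rule has_integral_cmul)
    moreover have "(\<lambda>s. (1 / sqrt \<delta>) *\<^sub>R (if s \<in> {p b..p b + \<delta>} then J i s else 0)) = (\<lambda>s. cell \<delta> (p b) (k b) s $ i *\<^sub>R J i s)"
      using True by (auto simp: cell_def fun_eq_iff indicator_def)
    ultimately show ?thesis using True by (simp add: D_def cell_deriv_def J_def[abs_def])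
  next
    case False
    then have "cell \<delta> (p b) (k b) s $ i = 0" for s by (simp add: cell_def axis_def)
    then show ?thesis using False by (simp add: D_def)
  qed
  have "((\<lambda>s. (\<Sum>b\<in>B. c b *\<^sub>R cell \<delta> (p b) (k b) s) $ i *\<^sub>R J i s) has_integral (\<Sum>b\<in>B. c b *\<^sub>R D b i)) {0..t}" for i
  proof -
    have "((\<lambda>s. \<Sum>b\<in>B. c b *\<^sub>R (cell \<delta> (p b) (k b) s $ i *\<^sub>R J i s)) has_integral (\<Sum>b\<in>B. c b *\<^sub>R D b i)) {0..t}"
      by (intro has_integral_sum B has_integral_cmul one)
    then show ?thesis by (simp add: sum_component scaleR_sum_left)
  qed
  then have "malliavin_deriv \<phi> Du \<sigma> t u V (\<lambda>s. \<Sum>b\<in>B. c b *\<^sub>R cell \<delta> (p b) (k b) s) = (\<Sum>i\<in>UNIV. \<Sum>b\<in>B. c b *\<^sub>R D b i)"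
    unfolding malliavin_deriv_def J_def by (intro sum.cong refl integral_unique)
  also have "\<dots> = (\<Sum>b\<in>B. \<Sum>i\<in>UNIV. c b *\<^sub>R D b i)" by (rule sum.swap)
  also have "\<dots> = (\<Sum>b\<in>B. c b *\<^sub>R cell_deriv \<phi> Du \<sigma> t u V \<delta> (p b) (k b))"
    by (simp add: D_def flip: scaleR_sum_right)
  finally show ?thesis .
qed

text \<open>Passing from \<open>W a\<close> to \<open>W y\<close> is a translation by one
  Cameron--Martin path with the coordinates of \<open>y - a\<close> as coefficients.
  Differentiability is therefore invoked at the path \<open>W a\<close>, where the derivative is
  also evaluated.\<close>

lemma has_derivative_cocycle_cells:
  fixes p :: "'m::euclidean_space \<Rightarrow> real" and k :: "'m \<Rightarrow> 'z::finite"
    and \<phi> :: "real \<Rightarrow> 'x::{real_inner,complete_space} \<Rightarrow> (real \<Rightarrow> real^'z) \<Rightarrow> 'x" and L :: "'x \<Rightarrow> 'm"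
  assumes \<phi>: "adapted_cocycle \<phi>" and A: "assumption_A \<phi> Du \<sigma>" and V: "V \<in> wiener_paths"
    and p: "\<And>b. b \<in> Basis \<Longrightarrow> 0 \<le> p b" "\<And>b. b \<in> Basis \<Longrightarrow> p b + \<delta> \<le> t" and \<delta>: "\<delta> > 0" and t: "t > 0"
    and L: "bounded_linear L"
  defines "W \<equiv> \<lambda>a r. V r + (\<Sum>b\<in>Basis. (a \<bullet> b) *\<^sub>R cell_path \<delta> (p b) (k b) r)"
  shows "W a \<in> wiener_paths"
    and "((\<lambda>a. L (\<phi> t u (W a))) has_derivative
      (\<lambda>d. \<Sum>b\<in>Basis. (d \<bullet> b) *\<^sub>R L (cell_deriv \<phi> Du \<sigma> t u (W a) \<delta> (p b) (k b)))) (at a)"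
proof -
  interpret L: bounded_linear L by fact
  show Wa: "W a \<in> wiener_paths"
    using V cell_path_wiener_paths[OF p(1) \<delta>]
    by (auto simp: W_def wiener_paths_def intro!: continuous_intros)
  define f' where "f' d = (\<Sum>b\<in>Basis. (d \<bullet> b) *\<^sub>R L (cell_deriv \<phi> Du \<sigma> t u (W a) \<delta> (p b) (k b)))" for d
  have "bounded_linear f'" unfolding f'_def
    by (intro bounded_linear_sum bounded_linear_scaleR_const bounded_linear_inner_left)
  moreover have "\<exists>d>0. \<forall>y. norm (y - a) < d \<longrightarrow> norm (L (\<phi> t u (W y)) - L (\<phi> t u (W a)) - f' (y - a)) \<le> e * norm (y - a)"
    if e: "e > 0" for e
  proof -
    obtain K where K: "K > 0" "\<And>x. norm (L x) \<le> norm x * K" using L.pos_bounded by blast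
    define C where "C = DIM('m) / sqrt \<delta> * sqrt t"
    have C: "C > 0" using \<delta> t by (simp add: C_def)
    \<comment> \<open>\<open>K\<close> bounds \<open>L\<close>, and \<open>C\<close> compares the
      Cameron--Martin norm with \<open>norm (y - a)\<close>.\<close>
    have "e / (K * C) > 0" using e K C by simp
    then obtain d where d: "d > 0" "\<And>h. h \<in> cm_space t \<Longrightarrow> cm_norm t h < d \<Longrightarrow>
       norm (\<phi> t u (\<lambda>s. W a s + cm_path t h s) - \<phi> t u (W a) - malliavin_deriv \<phi> Du \<sigma> t u (W a) h) \<le> e / (K * C) * cm_norm t h"
      using A[unfolded assumption_A_def, THEN conjunct1, rule_format, of t "W a" "e / (K * C)" u] Wa t by auto
    have "norm (L (\<phi> t u (W y)) - L (\<phi> t u (W a)) - f' (y - a)) \<le> e * norm (y - a)" if y: "norm (y - a) < d / C" for y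
    proof -
      define h where "h = (\<lambda>s. \<Sum>b\<in>Basis. ((y - a) \<bullet> b) *\<^sub>R cell \<delta> (p b) (k b) s)"
      have h: "h \<in> cm_space t" "cm_norm t h \<le> C * norm (y - a)"
        unfolding h_def C_def using cm_norm_cells[OF \<delta>, of t "y - a" p k] t by auto
      have hd: "cm_norm t h < d" using h(2) y C by (simp add: field_simps)
      have "cm_path t h = (\<lambda>r. \<Sum>b\<in>Basis. ((y - a) \<bullet> b) *\<^sub>R cell_path \<delta> (p b) (k b) r)"
        unfolding h_def using p \<delta> t by (intro cm_path_cells) auto
      then have W: "(\<lambda>s. W a s + cm_path t h s) = W y"
        unfolding W_def by (simp add: inner_diff_left scaleR_diff_left sum_subtractf)
      have "malliavin_deriv \<phi> Du \<sigma> t u (W a) h = (\<Sum>b\<in>Basis. ((y - a) \<bullet> b) *\<^sub>R cell_deriv \<phi> Du \<sigma> t u (W a) \<delta> (p b) (k b))"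
        unfolding h_def by (intro malliavin_deriv_cells \<phi> A Wa p \<delta> finite_Basis)
      then have "L (malliavin_deriv \<phi> Du \<sigma> t u (W a) h) = f' (y - a)"
        by (simp add: f'_def L.sum L.scale)
      then have "norm (L (\<phi> t u (W y)) - L (\<phi> t u (W a)) - f' (y - a))
          = norm (L (\<phi> t u (\<lambda>s. W a s + cm_path t h s) - \<phi> t u (W a) - malliavin_deriv \<phi> Du \<sigma> t u (W a) h))"
        by (simp add: W L.diff)
      also have "\<dots> \<le> (e / (K * C) * cm_norm t h) * K"
        by (rule order_trans[OF K(2)]) (rule mult_right_mono[OF d(2)[OF h(1) hd] less_imp_le[OF K(1)]])
      also have "\<dots> \<le> (e / (K * C) * (C * norm (y - a))) * K"
        using h(2) e K C by (intro mult_right_mono mult_left_mono) auto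
      also have "\<dots> = e * norm (y - a)" using K C by simp
      finally show ?thesis .
    qed
    then show ?thesis using d(1) C by (intro exI[of _ "d / C"]) auto
  qed
  ultimately show "((\<lambda>a. L (\<phi> t u (W a))) has_derivative
      (\<lambda>d. \<Sum>b\<in>Basis. (d \<bullet> b) *\<^sub>R L (cell_deriv \<phi> Du \<sigma> t u (W a) \<delta> (p b) (k b)))) (at a)"
    unfolding has_derivative_at_alt f'_def by blast
qed

section \<open>Absolute continuity\<close>

text \<open>Supplies a sequence converging to the derivative, through which measurability passes
  from the functional to its cell derivatives.\<close>

lemma has_derivative_difference_quotient:
  assumes "(g has_derivative g') (at x)"
  shows "(\<lambda>i. real (Suc i) *\<^sub>R (g (x + (1 / real (Suc i)) *\<^sub>R d) - g x)) \<longlonglongrightarrow> g' d"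
proof (rule LIMSEQ_I)
  fix r :: real assume r: "r > 0"
  have bl: "bounded_linear g'" using assms by (rule has_derivative_bounded_linear)
  define e where "e = r / (norm d + 1)"
  have "norm d + 1 > 0" by (simp add: add_nonneg_pos)
  then have e: "e > 0" "e * norm d < r"
    using r unfolding e_def by (simp_all add: field_simps)
  obtain \<delta> where \<delta>: "\<delta> > 0" "\<And>y. norm (y - x) < \<delta> \<Longrightarrow> norm (g y - g x - g' (y - x)) \<le> e * norm (y - x)"
    using assms e(1) unfolding has_derivative_at_alt by blast
  have "(\<lambda>i. norm d * (1 / real (Suc i))) \<longlonglongrightarrow> norm d * 0"
    by (intro tendsto_intros LIMSEQ_Suc lim_1_over_n)
  then have "eventually (\<lambda>i. norm d * (1 / real (Suc i)) < \<delta>) sequentially"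
    using \<delta>(1) by (intro order_tendstoD(2)) simp_all
  then obtain N where N: "\<And>i. i \<ge> N \<Longrightarrow> norm d * (1 / real (Suc i)) < \<delta>"
    unfolding eventually_sequentially by blast
  have "norm (real (Suc i) *\<^sub>R (g (x + (1 / real (Suc i)) *\<^sub>R d) - g x) - g' d) < r" if "i \<ge> N" for i
  proof -
    define y where "y = x + (1 / real (Suc i)) *\<^sub>R d"
    have ny: "norm (y - x) = norm d * (1 / real (Suc i))" by (simp add: y_def)
    have g'y: "g' d = real (Suc i) *\<^sub>R g' (y - x)"
      using linear_scale[OF bounded_linear.linear[OF bl], of "real (Suc i)" "y - x"] by (simp add: y_def del: of_nat_Suc)
    have "norm (real (Suc i) *\<^sub>R (g y - g x) - g' d) = real (Suc i) * norm (g y - g x - g' (y - x))"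
      unfolding g'y scaleR_diff_right[symmetric] by (simp del: of_nat_Suc)
    also have "\<dots> \<le> real (Suc i) * (e * norm (y - x))"
      using \<delta>(2)[of y] N[OF that] ny by (intro mult_left_mono) simp_all
    also have "\<dots> = e * norm d" unfolding ny by simp
    finally show ?thesis using e(2) unfolding y_def by linarith
  qed
  then show "\<exists>no. \<forall>n\<ge>no. norm (real (Suc n) *\<^sub>R (g (x + (1 / real (Suc n)) *\<^sub>R d) - g x) - g' d) < r" by blast
qed

text \<open>Both quantifiers become countable: \<kappa> may be taken among the reciprocals, and a
  violating \<open>d\<close> in a countable dense set, since violations form an open set.\<close>

lemma sets_bounded_below:
  fixes D :: "'m::euclidean_space \<Rightarrow> 'a \<Rightarrow> 'm"
  assumes [measurable]: "\<And>b. b \<in> Basis \<Longrightarrow> D b \<in> borel_measurable M"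
  shows "{x \<in> space M. \<exists>\<kappa>>0. \<forall>d. norm (\<Sum>b\<in>Basis. (d \<bullet> b) *\<^sub>R D b x) \<ge> \<kappa> * norm d} \<in> sets M"
proof -
  obtain Q :: "'m set" where Q: "countable Q" "\<And>X. open X \<Longrightarrow> X \<noteq> {} \<Longrightarrow> \<exists>d\<in>Q. d \<in> X"
    by (rule countable_dense_setE) blast
  have eq: "(\<exists>\<kappa>>0. \<forall>d. norm (\<Sum>b\<in>Basis. (d \<bullet> b) *\<^sub>R D b x) \<ge> \<kappa> * norm d)
     \<longleftrightarrow> (\<exists>j::nat. \<forall>d\<in>Q. norm (\<Sum>b\<in>Basis. (d \<bullet> b) *\<^sub>R D b x) \<ge> 1 / real (Suc j) * norm d)" (is "?l \<longleftrightarrow> ?r") for x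
  proof
    assume ?l
    then obtain \<kappa> where \<kappa>: "\<kappa> > 0" "\<And>d. norm (\<Sum>b\<in>Basis. (d \<bullet> b) *\<^sub>R D b x) \<ge> \<kappa> * norm d" by blast
    obtain j where j: "1 / real (Suc j) < \<kappa>" using reals_Archimedean[OF \<kappa>(1)] by (auto simp: inverse_eq_divide)
    have "1 / real (Suc j) * norm d \<le> norm (\<Sum>b\<in>Basis. (d \<bullet> b) *\<^sub>R D b x)" for d
      by (rule order_trans[OF mult_right_mono[OF less_imp_le[OF j]] \<kappa>(2)]) simp
    then show ?r by blast
  next
    assume ?r
    then obtain j :: nat where j: "\<And>d. d \<in> Q \<Longrightarrow> 1 / real (Suc j) * norm d \<le> norm (\<Sum>b\<in>Basis. (d \<bullet> b) *\<^sub>R D b x)" by blast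
    define U where "U = {d. norm (\<Sum>b\<in>Basis. (d \<bullet> b) *\<^sub>R D b x) < 1 / real (Suc j) * norm d}"
    have "open U" unfolding U_def by (intro open_Collect_less continuous_intros)
    moreover have "\<not> (\<exists>d\<in>Q. d \<in> U)" using j by (auto simp: U_def not_less)
    ultimately have "U = {}" using Q(2) by blast
    then have "1 / real (Suc j) * norm d \<le> norm (\<Sum>b\<in>Basis. (d \<bullet> b) *\<^sub>R D b x)" for d
      unfolding U_def by (auto simp: not_less)
    moreover have "1 / real (Suc j) > 0" by simp
    ultimately show ?l by blast
  qed
  have "{x \<in> space M. norm (\<Sum>b\<in>Basis. (d \<bullet> b) *\<^sub>R D b x) \<ge> 1 / real (Suc j) * norm d} \<in> sets M" for j :: nat and d
    by measurable
  then show ?thesis unfolding eq using Q(1)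
    by (intro sets.sets_Collect_countable_Ex sets.sets_Collect_countable_Ball) auto
qed

text \<open>Under resampling, the event becomes a set of pairs whose section at each path is null.
  The derivative in \<open>a\<close> and the condition \<open>good\<close> refer to the same
  displaced path, which is why \<open>good\<close> is made part of the event.\<close>

lemma AE_not_in_null_set_if_cells:
  fixes \<phi> :: "real \<Rightarrow> 'x::{real_inner, complete_space} \<Rightarrow> (real \<Rightarrow> real^'z::finite) \<Rightarrow> 'x"
    and L :: "'x \<Rightarrow> 'm::euclidean_space" and c :: "'m \<Rightarrow> nat \<times> 'z"
  assumes P: "two_sided_wiener P" and \<phi>: "adapted_cocycle \<phi>" and A: "assumption_A \<phi> Du \<sigma>"
    and L: "bounded_linear L" and t: "t > 0" and N: "N \<in> null_sets lborel"
    and n: "n > 0" and c: "inj_on c Basis" "\<And>b. b \<in> Basis \<Longrightarrow> fst (c b) < n"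
  shows "AE V in P. L (\<phi> t u V) \<in> N \<longrightarrow>
    \<not> (\<exists>\<kappa>>0. \<forall>d. norm (\<Sum>b\<in>Basis. (d \<bullet> b) *\<^sub>R
        L (cell_deriv \<phi> Du \<sigma> t u V (t / real n) (real (fst (c b)) * (t / real n)) (snd (c b)))) \<ge> \<kappa> * norm d)"
proof -
  define \<delta> where "\<delta> = t / real n"
  define p where "p b = real (fst (c b)) * \<delta>" for b
  define k where "k b = snd (c b)" for b
  define F where "F V = L (\<phi> t u V)" for V
  define D where "D b V = L (cell_deriv \<phi> Du \<sigma> t u V \<delta> (p b) (k b))" for b V
  define H where "H b = cell_path \<delta> (p b) (k b)" for b
  define W where "W V a r = V r + (\<Sum>b\<in>Basis. (a \<bullet> b) *\<^sub>R H b r)" for V a r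
  define good where "good V \<longleftrightarrow> (\<exists>\<kappa>>0. \<forall>d. norm (\<Sum>b\<in>Basis. (d \<bullet> b) *\<^sub>R D b V) \<ge> \<kappa> * norm d)" for V
  have \<delta>: "\<delta> > 0" using t n by (simp add: \<delta>_def)
  have p0: "0 \<le> p b" for b using \<delta> by (simp add: p_def)
  have pt: "p b + \<delta> \<le> t" if "b \<in> Basis" for b
  proof -
    have "real (Suc (fst (c b))) * \<delta> \<le> real n * \<delta>" using c(2)[OF that] \<delta> by (intro mult_right_mono) auto
    then show ?thesis using n by (simp add: p_def algebra_simps \<delta>_def)
  qed
  have Hwp: "H b \<in> wiener_paths" for b unfolding H_def by (rule cell_path_wiener_paths[OF p0 \<delta>])
  have deriv: "W V a \<in> wiener_paths"
    "((\<lambda>a. F (W V a)) has_derivative (\<lambda>d. \<Sum>b\<in>Basis. (d \<bullet> b) *\<^sub>R D b (W V a))) (at a)"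
    if "V \<in> wiener_paths" for V a
    using has_derivative_cocycle_cells(1)[where k = k and a = a, OF \<phi> A that p0 pt \<delta> t L]
      has_derivative_cocycle_cells(2)[where k = k and a = a and u = u, OF \<phi> A that p0 pt \<delta> t L]
    unfolding F_def W_def[abs_def] D_def H_def by auto
  have sp: "space P = wiener_paths" by (rule space_wiener[OF P])
  note [measurable] = measurable_wiener_eval[OF P]
  have Fm[measurable]: "F \<in> borel_measurable P" unfolding F_def by (rule borel_measurable_cocycle[OF P t \<phi> L])
  have Wm: "(\<lambda>V. W V a) \<in> measurable P P" for a
    by (rule measurable_into_wiener[OF P]) (use deriv(1) sp in \<open>auto simp: W_def\<close>)
  have Dm: "D b \<in> borel_measurable P" if b: "b \<in> Basis" for b
  proof (rule borel_measurable_LIMSEQ_metric)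
    show "(\<lambda>V. real (Suc i) *\<^sub>R (F (W V (0 + (1 / real (Suc i)) *\<^sub>R b)) - F (W V 0))) \<in> borel_measurable P" for i
      by (intro borel_measurable_scaleR borel_measurable_diff borel_measurable_const measurable_compose[OF Wm Fm])
    fix V assume "V \<in> space P"
    then have V: "V \<in> wiener_paths" using sp by simp
    have W0: "W V 0 = V" by (simp add: W_def fun_eq_iff)
    have "(\<Sum>b'\<in>Basis. (b \<bullet> b') *\<^sub>R D b' (W V 0)) = (\<Sum>b'\<in>Basis. if b' = b then D b V else 0)"
      using b by (intro sum.cong) (auto simp: inner_Basis W0)
    then show "(\<lambda>i. real (Suc i) *\<^sub>R (F (W V (0 + (1 / real (Suc i)) *\<^sub>R b)) - F (W V 0))) \<longlonglongrightarrow> D b V"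
      using has_derivative_difference_quotient[OF deriv(2)[OF V, of 0], of b] b by simp
  qed
  have Nb: "N \<in> sets borel" and Nn: "negligible N"
    using N by (auto simp: negligible_iff_null_sets null_sets_completionI)
  define E where "E = {V \<in> space P. F V \<in> N \<and> good V}"
  have "{V \<in> space P. F V \<in> N} \<in> sets P" using Nb by measurable
  moreover have "{V \<in> space P. good V} \<in> sets P" unfolding good_def by (rule sets_bounded_below[OF Dm])
  ultimately have "{V \<in> space P. F V \<in> N} \<inter> {V \<in> space P. good V} \<in> sets P" by (rule sets.Int)
  also have "{V \<in> space P. F V \<in> N} \<inter> {V \<in> space P. good V} = E" unfolding E_def by blast
  finally have Em: "E \<in> sets P" .
  define x where "x b = cell_increment \<delta> (p b) (k b)" for b
  have orth: "lin_ev (x b') (H b) = (if b = b' then 1 else 0)" if "b \<in> Basis" "b' \<in> Basis" for b b'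
    using lin_ev_cell_increment[OF \<delta>, of "fst (c b')" "k b'" "fst (c b)" "k b"] inj_onD[OF c(1), of b b'] that
    unfolding x_def H_def p_def k_def by (auto simp: prod_eq_iff)
  define T where "T = (\<lambda>(V, a). \<lambda>r. V r + (\<Sum>b\<in>Basis. (a \<bullet> b - lin_ev (x b) V) *\<^sub>R H b r))"
  have T: "T \<in> measurable (P \<Otimes>\<^sub>M std_gaussian) P" "distr (P \<Otimes>\<^sub>M std_gaussian) P T = P"
    unfolding T_def
    by (intro wiener_resample[OF P Hwp _ orth] ; simp add: x_def H_def lin_cov_cell_increment)+
  interpret P: prob_space P using P by (rule prob_space_wiener)
  interpret G: prob_space "std_gaussian :: 'm measure" by (rule prob_space_std_gaussian)
  have "emeasure P E = emeasure (distr (P \<Otimes>\<^sub>M std_gaussian) P T) E" by (simp add: T(2))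
  also have "\<dots> = emeasure (P \<Otimes>\<^sub>M std_gaussian) (T -` E \<inter> space (P \<Otimes>\<^sub>M std_gaussian))"
    by (rule emeasure_distr[OF T(1) Em])
  also have "\<dots> = (\<integral>\<^sup>+V. emeasure std_gaussian (Pair V -` (T -` E \<inter> space (P \<Otimes>\<^sub>M std_gaussian))) \<partial>P)"
    by (rule G.emeasure_pair_measure_alt[OF measurable_sets[OF T(1) Em]])
  also have "\<dots> = (\<integral>\<^sup>+V. 0 \<partial>P)"
  proof (rule nn_integral_cong)
    fix V assume "V \<in> space P"
    then have V: "V \<in> wiener_paths" using sp by simp
    \<comment> \<open>With its components along the \<open>H b\<close> removed, \<open>V0\<close>
      stays fixed in the section over \<open>V\<close>, and the resampled path is
      \<open>W V0 a\<close> with \<open>a\<close> free.\<close>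
    define V0 where "V0 r = V r - (\<Sum>b\<in>Basis. lin_ev (x b) V *\<^sub>R H b r)" for r
    have V0: "V0 \<in> wiener_paths"
      using V Hwp unfolding V0_def wiener_paths_def by (auto intro!: continuous_intros)
    have TW: "T (V, a) = W V0 a" for a
      by (simp add: T_def W_def V0_def fun_eq_iff scaleR_diff_left sum_subtractf)
    let ?R = "Pair V -` (T -` E \<inter> space (P \<Otimes>\<^sub>M std_gaussian))"
    have Rb: "?R \<in> sets borel"
      using sets_Pair1[OF measurable_sets[OF T(1) Em], of V] by simp
    have "negligible {a. F (W V0 a) \<in> N \<and> good (W V0 a)}"
    proof (rule negligible_vimage_nonsingular[OF deriv(2)[OF V0] _ Nn])
      fix a assume "a \<in> {a. F (W V0 a) \<in> N \<and> good (W V0 a)}"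
      then show "\<exists>\<kappa>>0. \<forall>d. \<kappa> * norm d \<le> norm (\<Sum>b\<in>Basis. (d \<bullet> b) *\<^sub>R D b (W V0 a))"
        by (simp add: good_def)
    qed blast
    then have "negligible ?R"
      by (rule negligible_subset) (auto simp: E_def TW)
    then show "emeasure std_gaussian ?R = 0" using Rb by (intro null_sets_std_gaussian)
  qed
  also have "\<dots> = 0" by simp
  finally have "E \<in> null_sets P" using Em by blast
  then have "AE V in P. V \<notin> E" by (rule AE_not_in)
  then show ?thesis
    by (rule AE_mp) (intro AE_I2, auto simp: E_def F_def good_def D_def p_def k_def \<delta>_def)
qed

text \<open>A deterministic statement on one path. If \<eta> is orthogonal to all
  \<open>L (J k s)\<close>, Riesz pulls it back to a vector \<open>z\<close> on which the Malliavin
  form vanishes; so \<open>z = 0\<close>, and \<open>\<eta> = 0\<close> as \<open>L\<close> is onto.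
  This is what \<open>grid_averages_span\<close> asks for.\<close>

lemma nondegenerate_imp_cells:
  fixes \<phi> :: "real \<Rightarrow> 'x::{real_inner, complete_space} \<Rightarrow> (real \<Rightarrow> real^'z::finite) \<Rightarrow> 'x"
    and L :: "'x \<Rightarrow> 'm::euclidean_space"
  assumes \<phi>: "adapted_cocycle \<phi>" and A: "assumption_A \<phi> Du \<sigma>"
    and L: "bounded_linear L" "surj L" and t: "t > 0" and V: "V \<in> wiener_paths"
    and nd: "\<And>\<xi>. \<xi> \<noteq> 0 \<Longrightarrow> malliavin_form \<phi> Du \<sigma> t u V \<xi> \<xi> > 0"
  obtains n :: nat and c :: "'m \<Rightarrow> nat \<times> 'z" and \<kappa> :: real where "n > 0" "c \<in> Basis \<rightarrow>\<^sub>E {..<n} \<times> UNIV" "inj_on c Basis" "\<kappa> > 0"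
    "\<And>d. norm (\<Sum>b\<in>Basis. (d \<bullet> b) *\<^sub>R
        L (cell_deriv \<phi> Du \<sigma> t u V (t / real n) (real (fst (c b)) * (t / real n)) (snd (c b)))) \<ge> \<kappa> * norm d"
proof -
  interpret L: bounded_linear L by fact
  define J where "J k s = jac \<phi> Du s t u V (\<sigma> k)" for k s
  have Jc: "continuous_on {0..t} (J k)" for k unfolding J_def by (rule continuous_on_jac[OF \<phi> A V])
  have contL: "continuous_on {0..t} (\<lambda>s. L (J k s))" for k by (rule L.continuous_on[OF Jc])
  have ndL: "\<eta> = 0" if \<eta>: "\<And>k s. s \<in> {0..t} \<Longrightarrow> L (J k s) \<bullet> \<eta> = 0" for \<eta>
  proof -
    have "bounded_linear (\<lambda>x. L x \<bullet> \<eta>)"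
      using bounded_linear_compose[OF bounded_linear_inner_left L(1)] .
    from Riesz_representation[OF this] obtain z where z: "\<And>x. L x \<bullet> \<eta> = x \<bullet> z" by blast
    have "malliavin_form \<phi> Du \<sigma> t u V z z = (\<Sum>k\<in>UNIV. integral {0..t} (\<lambda>s. (J k s \<bullet> z) * (J k s \<bullet> z)))"
      by (simp add: malliavin_form_def J_def)
    also have "\<dots> = (\<Sum>k\<in>(UNIV::'z set). integral {0..t} (\<lambda>s. 0))"
      by (intro sum.cong refl integral_cong) (use \<eta> z in auto)
    finally have "z = 0" using nd[of z] by fastforce
    moreover obtain x where "L x = \<eta>" using L(2) by (metis surjD)
    ultimately show ?thesis using z[of x] by simp
  qed
  obtain n :: nat where n: "n > 0"
    and span: "span {integral {real j * (t / n)..real j * (t / n) + t / n} (\<lambda>s. L (J k s)) | j k. j < n} = UNIV"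
  proof (rule grid_averages_span[where v = "\<lambda>k s. L (J k s)", OF t])
    show "continuous_on {0..t} (\<lambda>s. L (J k s))" for k by (rule contL)
    show "\<eta> = 0" if "\<And>k s. s \<in> {0..t} \<Longrightarrow> L (J k s) \<bullet> \<eta> = 0" for \<eta> using that by (rule ndL)
  qed (rule that)
  define \<delta> where "\<delta> = t / real n"
  have \<delta>: "\<delta> > 0" using t n by (simp add: \<delta>_def)
  define I where "I j k = integral {real j * \<delta>..real j * \<delta> + \<delta>} (\<lambda>s. L (J k s))" for j :: nat and k
  have span': "span {I j k | j k. j < n} = UNIV" using span unfolding I_def \<delta>_def .
  obtain e \<kappa> where e: "inj_on e (Basis::'m set)" "e ` (Basis :: 'm set) \<subseteq> {I j k | j k. j < n}" and \<kappa>: "\<kappa> > 0"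
    "\<And>d. norm (\<Sum>b\<in>Basis. (d \<bullet> b) *\<^sub>R e b) \<ge> \<kappa> * norm d"
    by (rule spanning_set_imp_frame[OF span']; rule that; assumption)
  have "\<forall>b\<in>Basis. \<exists>q. fst q < n \<and> e b = I (fst q) (snd q)" using e(2) by fastforce
  from bchoice[OF this] obtain c0 where c0: "\<And>b. b \<in> Basis \<Longrightarrow> fst (c0 b) < n \<and> e b = I (fst (c0 b)) (snd (c0 b))" by blast
  \<comment> \<open>The restriction puts \<open>c\<close> into a finite set for each
    \<open>n\<close>, so that all choices together are countable.\<close>
  define c where "c = restrict c0 Basis"
  have c: "fst (c b) < n" "e b = I (fst (c b)) (snd (c b))" if "b \<in> Basis" for b
    using c0[OF that] that by (simp_all add: c_def)
  have cd: "L (cell_deriv \<phi> Du \<sigma> t u V \<delta> (real (fst (c b)) * \<delta>) (snd (c b))) = (1 / sqrt \<delta>) *\<^sub>R e b" if b: "b \<in> Basis" for b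
  proof -
    have "real (Suc (fst (c b))) * \<delta> \<le> real n * \<delta>" using c(1)[OF b] \<delta> by (intro mult_right_mono) auto
    then have sub: "{real (fst (c b)) * \<delta>..real (fst (c b)) * \<delta> + \<delta>} \<subseteq> {0..t}"
      using n t by (auto simp: algebra_simps \<delta>_def intro: order_trans[rotated])
    have Ji: "J (snd (c b)) integrable_on {real (fst (c b)) * \<delta>..real (fst (c b)) * \<delta> + \<delta>}"
      by (rule integrable_continuous_inner[OF continuous_on_subset[OF Jc sub]])
    have "L (integral {real (fst (c b)) * \<delta>..real (fst (c b)) * \<delta> + \<delta>} (J (snd (c b)))) = e b"
      using integral_linear[OF Ji L(1)] c(2)[OF b] by (simp add: I_def comp_def)
    then show ?thesis by (simp add: cell_deriv_def J_def[abs_def] L.scale)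
  qed
  show ?thesis
  proof (rule that[OF n])
    show "c \<in> Basis \<rightarrow>\<^sub>E {..<n} \<times> UNIV"
      using c(1) by (auto simp: c_def PiE_def mem_Times_iff)
    show "inj_on c Basis" using e(1) c(2) by (metis inj_on_def)
    \<comment> \<open>The factor comes from the normalisation in \<open>cell_deriv\<close>.\<close>
    show "\<kappa> / sqrt \<delta> > 0" using \<kappa> \<delta> by simp
    fix d :: 'm
    have "(\<Sum>b\<in>Basis. (d \<bullet> b) *\<^sub>R L (cell_deriv \<phi> Du \<sigma> t u V \<delta> (real (fst (c b)) * \<delta>) (snd (c b))))
        = (\<Sum>b\<in>Basis. (1 / sqrt \<delta>) *\<^sub>R ((d \<bullet> b) *\<^sub>R e b))"
      by (intro sum.cong refl) (simp add: cd)
    also have "\<dots> = (1 / sqrt \<delta>) *\<^sub>R (\<Sum>b\<in>Basis. (d \<bullet> b) *\<^sub>R e b)" by (simp only: scaleR_sum_right)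
    finally show "\<kappa> / sqrt \<delta> * norm d \<le> norm (\<Sum>b\<in>Basis. (d \<bullet> b) *\<^sub>R
        L (cell_deriv \<phi> Du \<sigma> t u V (t / real n) (real (fst (c b)) * (t / real n)) (snd (c b))))"
      using \<kappa>(2)[of d] \<delta> unfolding \<delta>_def[symmetric] by (simp add: divide_right_mono)
  qed
qed

theorem theorem4p12:
  fixes \<phi> :: "real \<Rightarrow> 'x::{real_inner, complete_space} \<Rightarrow> (real \<Rightarrow> real^'z::finite) \<Rightarrow> 'x"
    and Du :: "real \<Rightarrow> 'x \<Rightarrow> (real \<Rightarrow> real^'z) \<Rightarrow> 'x \<Rightarrow> 'x"
    and \<sigma> :: "'z \<Rightarrow> 'x"
    and P :: "(real \<Rightarrow> real^'z) measure"
    and \<pi> :: "'x \<Rightarrow> 'x"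
    and \<iota> :: "'x \<Rightarrow> 'm::euclidean_space"
    and u :: 'x and t :: real
  assumes "two_sided_wiener P"
    and "adapted_cocycle \<phi>"
    and "assumption_A \<phi> Du \<sigma>"
    and "bounded_linear \<pi>" and "\<And>x. \<pi> (\<pi> x) = \<pi> x"
    and "linear \<iota>" and "bij_betw \<iota> (range \<pi>) UNIV"
    and "t > 0"
    and "AE V in P. \<forall>\<xi>. \<xi> \<noteq> 0 \<longrightarrow> malliavin_form \<phi> Du \<sigma> t u V \<xi> \<xi> > 0"
  shows "(\<lambda>V. \<iota> (\<pi> (\<phi> t u V))) \<in> borel_measurable P \<and>
         absolutely_continuous lborel (distr P lborel (\<lambda>V. \<iota> (\<pi> (\<phi> t u V))))"
proof -
  define L where "L x = \<iota> (\<pi> x)" for x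
  have L: "bounded_linear L" unfolding L_def by (rule bounded_linear_finite_range) fact+
  have surjL: "surj L" using \<open>bij_betw \<iota> (range \<pi>) UNIV\<close>
    unfolding L_def bij_betw_def by (simp add: image_image)
  have m[measurable]: "(\<lambda>V. L (\<phi> t u V)) \<in> borel_measurable P"
    by (rule borel_measurable_cocycle) (fact assms L)+
  define good where "good V n c \<longleftrightarrow> (\<exists>\<kappa>>0. \<forall>d. norm (\<Sum>b\<in>Basis. (d \<bullet> b) *\<^sub>R
        L (cell_deriv \<phi> Du \<sigma> t u V (t / real n) (real (fst (c b)) * (t / real n)) (snd (c b)))) \<ge> \<kappa> * norm d)"
    for V and n :: nat and c :: "'m \<Rightarrow> nat \<times> 'z"
  have "N \<in> null_sets (distr P lborel (\<lambda>V. L (\<phi> t u V)))" if N: "N \<in> null_sets lborel" for N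
  proof -
    define C where "C n = {c \<in> Basis \<rightarrow>\<^sub>E {..<n} \<times> (UNIV :: 'z set). inj_on c (Basis :: 'm set)}" for n :: nat
    have "finite (C n)" for n unfolding C_def by (simp add: finite_PiE)
    then have "countable (C n)" for n by (rule countable_finite)
    moreover have "AE V in P. L (\<phi> t u V) \<in> N \<longrightarrow> \<not> good V n c" if "n > 0" "c \<in> C n" for n c
      unfolding good_def using that
      by (intro AE_not_in_null_set_if_cells[OF assms(1-3) L assms(8) N]) (auto simp: C_def PiE_def Pi_def mem_Times_iff)
    \<comment> \<open>The exceptional sets are united over all choices before a path is fixed, since
      the choice that works depends on the path.\<close>
    ultimately have "AE V in P. \<forall>n\<in>{0<..}. \<forall>c\<in>C n. L (\<phi> t u V) \<in> N \<longrightarrow> \<not> good V n c"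
      by (intro AE_ball_countable[THEN iffD2] ballI countableI_type) auto
    with assms(9) AE_space have "AE V in P. L (\<phi> t u V) \<notin> N"
    proof eventually_elim
      case (elim V)
      show ?case
      proof
        assume "L (\<phi> t u V) \<in> N"
        then have bad: "\<not> good V n c" if "n > 0" "c \<in> C n" for n c using elim(3) that by simp
        have "V \<in> wiener_paths" using elim(2) space_wiener[OF assms(1)] by simp
        from nondegenerate_imp_cells[OF assms(2,3) L surjL assms(8) this, of u] elim(1)
        obtain n \<kappa> and c :: "'m \<Rightarrow> nat \<times> 'z" where "n > 0" "c \<in> Basis \<rightarrow>\<^sub>E {..<n} \<times> UNIV" "inj_on c Basis" "\<kappa> > 0"
          "\<And>d. norm (\<Sum>b\<in>Basis. (d \<bullet> b) *\<^sub>R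
            L (cell_deriv \<phi> Du \<sigma> t u V (t / real n) (real (fst (c b)) * (t / real n)) (snd (c b)))) \<ge> \<kappa> * norm d"
          by blast
        then show False using bad[of n c] unfolding good_def C_def by blast
      qed
    qed
    moreover have Nb: "N \<in> sets borel" using N by auto
    have "(\<lambda>V. L (\<phi> t u V)) -` N \<inter> space P \<in> sets P" by (rule measurable_sets[OF m Nb])
    ultimately have "(\<lambda>V. L (\<phi> t u V)) -` N \<inter> space P \<in> null_sets P"
      by (subst AE_iff_null_sets) (auto elim: eventually_mono)
    then show ?thesis using Nb m by (subst null_sets_distr_iff) auto
  qed
  then show ?thesis using m by (auto simp: absolutely_continuous_def L_def)
qed

end
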